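(* Let $\Phi=(G,\varphi)$ be a $\mathbb{T}$-gain graph on a unicyclic graph $G$ with girth $r$ (the length of its unique cycle). (i) If $r\equiv 0\pmod 4$, then $\mathcal{E}(\Phi)\ge\mathcal{E}(G)$, with equality if and only if $\Phi$ is balanced. (ii) If $r\equiv 1\pmod 4$ or $r\equiv 3\pmod 4$, then $\mathcal{E}(\Phi)\le\mathcal{E}(G)$, with equality if and only if $\Phi$ or $-\Phi$ is balanced. (iii) If $r\equiv 2\pmod 4$, then $\mathcal{E}(\Phi)\le\mathcal{E}(G)$, with equality if and only if $\Phi$ is balanced.
   Context: Let $\mathbb{T}=\{z\in\mathbb{C}:|z|=1\}$. A $\mathbb{T}$-gain graph $\Phi=(G,\varphi)$ is a simple graph $G$ with a map $\varphi$ assigning to each oriented edge $\vec e_{p,q}$ a value in $\mathbb{T}$ with $\varphi(\vec{e}_{p,q})=\varphi(\vec{e}_{q,p})^{-1}$; its adjacency matrix $A(\Phi)$ has $(p,q)$ entry $\varphi(\vec{e}_{p,q})$ if $v_p\sim v_q$ and $0$ otherwise, and its energy $\mathcal{E}(\Phi)$ is the sum of absolute values of the eigenvalues of $A(\Phi)$. $\mathcal{E}(G)$ is the energy of the ordinary adjacency matrix of $G$. $-\Phi=(G,-\varphi)$. The gain of a cycle $v_1\sim\cdots\sim v_k\sim v_1$ is $\varphi(\vec e_{1,2})\cdots\varphi(\vec e_{k,1})$; $\Phi$ is balanced if every cycle has gain $1$. A unicyclic graph is a connected graph with exactly one cycle. *)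

theory Defs
  imports
    "Jordan_Normal_Form.Char_Poly"
    "Graph_Theory.Graph_Theory"
begin

text \<open>Simple graphs are finite, symmetric, loop-free pair digraphs (locale \<^locale>\<open>pair_graph\<close>):
  each undirected edge is represented by its two orientations, which are the arcs.\<close>

text \<open>In a symmetric digraph the closed walk $u, v, u$ is a cycle in the sense of
  \<^const>\<open>pre_digraph.cycle\<close>; the length bound excludes it, so that exactly the cycles of the
  undirected graph (with a base point and an orientation) remain.\<close>

definition graph_cycle :: "'a pair_pre_digraph \<Rightarrow> ('a \<times> 'a) list \<Rightarrow> bool" where
  "graph_cycle G p \<longleftrightarrow> pre_digraph.cycle (with_proj G) p \<and> 3 \<le> length p"

text \<open>Forgets base point and orientation: the undirected edges traversed by a walk.\<close>

definition undirected_edges :: "('a \<times> 'a) list \<Rightarrow> 'a set set" where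
  "undirected_edges p = (\<lambda>(u, v). {u, v}) ` set p"

text \<open>\<^const>\<open>Digraph_Component.connected\<close> includes that the vertex set is nonempty.\<close>

definition unicyclic :: "'a pair_pre_digraph \<Rightarrow> bool" where
  "unicyclic G \<longleftrightarrow> Digraph_Component.connected (with_proj G) \<and>
     (\<exists>!C. \<exists>p. graph_cycle G p \<and> C = undirected_edges p)"

definition girth :: "'a pair_pre_digraph \<Rightarrow> nat" where
  "girth G = (LEAST k. \<exists>p. graph_cycle G p \<and> length p = k)"

text \<open>The values of the gain function outside of the arcs of the graph are irrelevant.\<close>

locale gain_graph = pair_graph G for G :: "'a pair_pre_digraph" +
  fixes \<phi> :: "'a \<times> 'a \<Rightarrow> complex"
  assumes gain_unit: "e \<in> parcs G \<Longrightarrow> cmod (\<phi> e) = 1"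
    and gain_reverse: "(u, v) \<in> parcs G \<Longrightarrow> \<phi> (u, v) = inverse (\<phi> (v, u))"

definition walk_gain :: "('a \<times> 'a \<Rightarrow> complex) \<Rightarrow> ('a \<times> 'a) list \<Rightarrow> complex" where
  "walk_gain \<phi> p = (\<Prod>e\<leftarrow>p. \<phi> e)"

definition balanced :: "'a pair_pre_digraph \<Rightarrow> ('a \<times> 'a \<Rightarrow> complex) \<Rightarrow> bool" where
  "balanced G \<phi> \<longleftrightarrow> (\<forall>p. graph_cycle G p \<longrightarrow> walk_gain \<phi> p = 1)"

text \<open>The list \<^term>\<open>vs\<close> is an enumeration of the vertices, fixing the order of rows and columns.\<close>

definition adjacency_mat :: "'a pair_pre_digraph \<Rightarrow> 'a list \<Rightarrow> complex mat" where
  "adjacency_mat G vs = mat (length vs) (length vs)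
     (\<lambda>(i, j). if (vs ! i, vs ! j) \<in> parcs G then 1 else 0)"

definition gain_adjacency_mat ::
  "'a pair_pre_digraph \<Rightarrow> ('a \<times> 'a \<Rightarrow> complex) \<Rightarrow> 'a list \<Rightarrow> complex mat" where
  "gain_adjacency_mat G \<phi> vs = mat (length vs) (length vs)
     (\<lambda>(i, j). if (vs ! i, vs ! j) \<in> parcs G then \<phi> (vs ! i, vs ! j) else 0)"

text \<open>Eigenvalues are counted with algebraic multiplicity.\<close>

definition mat_energy :: "complex mat \<Rightarrow> real" where
  "mat_energy A = (\<Sum>\<mu>\<in>#proots (char_poly A). cmod \<mu>)"

definition graph_energy :: "'a pair_pre_digraph \<Rightarrow> 'a list \<Rightarrow> real" where
  "graph_energy G vs = mat_energy (adjacency_mat G vs)"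

definition gain_energy ::
  "'a pair_pre_digraph \<Rightarrow> ('a \<times> 'a \<Rightarrow> complex) \<Rightarrow> 'a list \<Rightarrow> real" where
  "gain_energy G \<phi> vs = mat_energy (gain_adjacency_mat G \<phi> vs)"

end

theory Submission
  imports Defs "HOL-Combinatorics.Cycles" "HOL-Real_Asymp.Real_Asymp"
begin

text \<open>In the Leibniz expansion of the characteristic polynomial $P$ at $iy$, only permutations moving
  vertices along arcs contribute. Involutions contribute $i^n y^k$, where $k$ is the number of fixed
  points. Any other contributing permutation has exactly one orbit of length at least 3, namely the
  cycle of $G$ in one of its two orientations, and contributes $-g\,i^{n-r} y^k$, where $g$ is the gain
  of the cycle in that orientation. Pairing each permutation with its inverse replaces $g$ by its real
  part $h$, so that $|P(iy)| = |i^r M(y) - h N(y)|$ with $M, N > 0$ for $y > 0$ independent of the gains.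
  Since a pointwise strict inequality of $|P(iy)|$ for all $y > 0$ implies a strict inequality of
  energies, everything depends only on comparing $h$ with the value 1 of the ungained graph.\<close>

section \<open>Comparing sums of absolute values\<close>

definition log_primitive :: "real \<Rightarrow> real \<Rightarrow> real" where
  "log_primitive a x = x * ln (x\<^sup>2 + a\<^sup>2) + 2 * a * arctan (x / a) - 2 * x"

lemma log_primitive_deriv:
  assumes "x > 0"
  shows "(log_primitive a has_real_derivative ln (x\<^sup>2 + a\<^sup>2)) (at x)"
proof -
  have pos: "x\<^sup>2 + a\<^sup>2 > 0" using assms by (simp add: add_pos_nonneg)
  show ?thesis
  proof (cases "a = 0")
    case True
    show ?thesis unfolding log_primitive_def[abs_def] True
      using assms by (auto intro!: derivative_eq_intros simp: power2_eq_square)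
  next
    case False
    have ne: "x\<^sup>2 + a\<^sup>2 \<noteq> 0" using pos by (rule less_imp_neq[symmetric])
    have "2 * a * (1 / a * inverse (1 + (x / a)\<^sup>2)) = 2 * a\<^sup>2 / (x\<^sup>2 + a\<^sup>2)"
      using False pos by (simp add: field_simps power2_eq_square)
    moreover have "x * (2 * x / (x\<^sup>2 + a\<^sup>2)) + 2 * a\<^sup>2 / (x\<^sup>2 + a\<^sup>2) = 2"
      using ne by (simp add: divide_simps) (simp add: power2_eq_square algebra_simps)
    ultimately have eq: "1 * ln (x\<^sup>2 + a\<^sup>2) + x * (2 * x / (x\<^sup>2 + a\<^sup>2))
        + 2 * a * (1 / a * inverse (1 + (x / a)\<^sup>2)) - 2 = ln (x\<^sup>2 + a\<^sup>2)"
      by simp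
    have "((\<lambda>x. x * ln (x\<^sup>2 + a\<^sup>2) + 2 * a * arctan (x / a) - 2 * x) has_real_derivative
        1 * ln (x\<^sup>2 + a\<^sup>2) + x * (2 * x / (x\<^sup>2 + a\<^sup>2))
        + 2 * a * (1 / a * inverse (1 + (x / a)\<^sup>2)) - 2) (at x)"
      using pos by (auto intro!: derivative_eq_intros)
    then show ?thesis unfolding log_primitive_def[abs_def] eq .
  qed
qed

lemma log_primitive_at_right_0: "(log_primitive a \<longlongrightarrow> 0) (at_right 0)"
proof (cases "a = 0")
  case True
  show ?thesis unfolding log_primitive_def[abs_def] True by simp real_asymp
next
  case False
  have "a\<^sup>2 > 0" using False by simp
  have "((\<lambda>x. x * ln (x\<^sup>2 + a\<^sup>2) + 2 * a * arctan (x / a) - 2 * x) \<longlongrightarrow>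
      0 * ln (0\<^sup>2 + a\<^sup>2) + 2 * a * arctan (0 / a) - 2 * 0) (at_right 0)"
    by (intro tendsto_intros) (use False in auto)
  then show ?thesis unfolding log_primitive_def[abs_def] by simp
qed

lemma log_primitive_at_top:
  "((\<lambda>x. log_primitive a x - log_primitive 0 x) \<longlongrightarrow> pi * \<bar>a\<bar>) at_top"
proof (cases a "0::real" rule: linorder_cases)
  case greater
  have "((\<lambda>x. x * ln (x\<^sup>2 + a\<^sup>2) + 2 * a * arctan (x / a) - 2 * x - (x * ln (x\<^sup>2) - 2 * x))
    \<longlongrightarrow> pi * a) at_top" using greater by real_asymp
  then show ?thesis using greater unfolding log_primitive_def[abs_def] by simp
next
  case less
  have "((\<lambda>x. x * ln (x\<^sup>2 + a\<^sup>2) + 2 * a * arctan (x / a) - 2 * x - (x * ln (x\<^sup>2) - 2 * x))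
    \<longlongrightarrow> pi * (-a)) at_top" using less by real_asymp
  then show ?thesis using less unfolding log_primitive_def[abs_def] by simp
qed simp

lemma DERIV_sum_mset:
  fixes f :: "'b \<Rightarrow> real \<Rightarrow> real"
  assumes "\<And>a. a \<in># A \<Longrightarrow> (f a has_real_derivative f' a) (at x)"
  shows "((\<lambda>x. \<Sum>a\<in>#A. f a x) has_real_derivative (\<Sum>a\<in>#A. f' a)) (at x)"
  using assms by (induction A) (auto intro!: derivative_intros)

lemma tendsto_sum_mset:
  fixes f :: "'b \<Rightarrow> 'c \<Rightarrow> real"
  assumes "\<And>a. a \<in># A \<Longrightarrow> (f a \<longlongrightarrow> l a) F"
  shows "((\<lambda>x. \<Sum>a\<in>#A. f a x) \<longlongrightarrow> (\<Sum>a\<in>#A. l a)) F"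
  using assms by (induction A) (auto intro!: tendsto_intros)

lemma ln_prod_mset:
  fixes f :: "'b \<Rightarrow> real"
  assumes "\<And>a. a \<in># A \<Longrightarrow> f a > 0"
  shows "(\<Prod>a\<in>#A. f a) > 0 \<and> ln (\<Prod>a\<in>#A. f a) = (\<Sum>a\<in>#A. ln (f a))"
  using assms
proof (induction A)
  case (add x A)
  then have "f x > 0" "(\<Prod>a\<in>#A. f a) > 0 \<and> ln (\<Prod>a\<in>#A. f a) = (\<Sum>a\<in>#A. ln (f a))"
    by simp_all
  then show ?case by (simp add: ln_mult_pos)
qed simp

text \<open>The difference of the sums of primitives has the logarithm of the quotient of both products
  as derivative; it tends to 0 at 0 and to $\pi$ times the difference of the sums of absolute values
  at infinity. This replaces the Coulson integral formula.\<close>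

lemma sum_abs_compare:
  fixes A B :: "real multiset"
  assumes size: "size A = size B"
    and le: "\<And>x. x > 0 \<Longrightarrow> (\<Prod>a\<in>#A. x\<^sup>2 + a\<^sup>2) \<le> (\<Prod>b\<in>#B. x\<^sup>2 + b\<^sup>2)"
  shows "(\<Sum>a\<in>#A. \<bar>a\<bar>) \<le> (\<Sum>b\<in>#B. \<bar>b\<bar>)"
    and "(\<And>x. x > 0 \<Longrightarrow> (\<Prod>a\<in>#A. x\<^sup>2 + a\<^sup>2) \<noteq> (\<Prod>b\<in>#B. x\<^sup>2 + b\<^sup>2)) \<Longrightarrow>
      (\<Sum>a\<in>#A. \<bar>a\<bar>) < (\<Sum>b\<in>#B. \<bar>b\<bar>)"
proof -
  define D where "D x = (\<Sum>b\<in>#B. log_primitive b x) - (\<Sum>a\<in>#A. log_primitive a x)" for x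
  define D' where "D' x = ln (\<Prod>b\<in>#B. x\<^sup>2 + b\<^sup>2) - ln (\<Prod>a\<in>#A. x\<^sup>2 + a\<^sup>2)" for x
  have pos: "x\<^sup>2 + a\<^sup>2 > 0" if "x > 0" for x a :: real using that by (simp add: add_pos_nonneg)
  have deriv: "(D has_real_derivative D' x) (at x)" if "x > 0" for x
  proof -
    have "D' x = (\<Sum>b\<in>#B. ln (x\<^sup>2 + b\<^sup>2)) - (\<Sum>a\<in>#A. ln (x\<^sup>2 + a\<^sup>2))"
      using ln_prod_mset[of A "\<lambda>a. x\<^sup>2 + a\<^sup>2"] ln_prod_mset[of B "\<lambda>a. x\<^sup>2 + a\<^sup>2"] pos[OF that]
      by (simp add: D'_def)
    then show ?thesis unfolding D_def[abs_def]
      using that by (auto intro!: DERIV_diff DERIV_sum_mset log_primitive_deriv)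
  qed
  have prod_pos: "(\<Prod>a\<in>#A. x\<^sup>2 + a\<^sup>2) > 0" if "x > 0" for x and A :: "real multiset"
    using ln_prod_mset[of A "\<lambda>a. x\<^sup>2 + a\<^sup>2"] pos[OF that] by simp
  have D'_nonneg: "D' x \<ge> 0" if "x > 0" for x
    using le[OF that] prod_pos[OF that] by (simp add: D'_def)
  have mono: "D x \<le> D y" if "0 < x" "x \<le> y" for x y
  proof (rule DERIV_nonneg_imp_nondecreasing[OF that(2)])
    fix z assume "x \<le> z" "z \<le> y"
    then show "\<exists>d. (D has_real_derivative d) (at z) \<and> 0 \<le> d"
      using that deriv[of z] D'_nonneg[of z] by (intro exI[of _ "D' z"]) auto
  qed
  have "(D \<longlongrightarrow> (\<Sum>b\<in>#B. 0) - (\<Sum>a\<in>#A. 0)) (at_right 0)"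
    unfolding D_def[abs_def]
    by (intro tendsto_diff tendsto_sum_mset log_primitive_at_right_0)
  then have lim0: "(D \<longlongrightarrow> 0) (at_right 0)" by simp
  have shift: "(\<Sum>a\<in>#A. log_primitive a x) =
    (\<Sum>a\<in>#A. log_primitive a x - log_primitive 0 x) + real (size A) * log_primitive 0 x"
    for A :: "real multiset" and x
    by (induction A) (auto simp: algebra_simps)
  have D_eq: "D x = (\<Sum>b\<in>#B. log_primitive b x - log_primitive 0 x)
      - (\<Sum>a\<in>#A. log_primitive a x - log_primitive 0 x)" for x
    unfolding D_def using shift[of x A] shift[of x B] size by simp
  have "(D \<longlongrightarrow> (\<Sum>b\<in>#B. pi * \<bar>b\<bar>) - (\<Sum>a\<in>#A. pi * \<bar>a\<bar>)) at_top"
    unfolding D_eq[abs_def]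
    by (intro tendsto_diff tendsto_sum_mset log_primitive_at_top)
  then have lim_top: "(D \<longlongrightarrow> pi * ((\<Sum>b\<in>#B. \<bar>b\<bar>) - (\<Sum>a\<in>#A. \<bar>a\<bar>))) at_top"
    by (simp add: sum_mset_distrib_left right_diff_distrib multiset.map_comp o_def)
  have nonneg: "D x \<ge> 0" if "x > 0" for x
  proof (rule tendsto_upperbound[OF lim0])
    show "\<forall>\<^sub>F y in at_right 0. D y \<le> D x"
      using that mono by (auto simp: eventually_at_right intro!: exI[of _ x])
  qed simp
  have above: "D x \<le> pi * ((\<Sum>b\<in>#B. \<bar>b\<bar>) - (\<Sum>a\<in>#A. \<bar>a\<bar>))" if "x > 0" for x
  proof (rule tendsto_lowerbound[OF lim_top])
    show "\<forall>\<^sub>F y in at_top. D x \<le> D y"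
      using that mono by (auto simp: eventually_at_top_linorder intro!: exI[of _ x])
  qed simp
  have "0 \<le> pi * ((\<Sum>b\<in>#B. \<bar>b\<bar>) - (\<Sum>a\<in>#A. \<bar>a\<bar>))"
    using nonneg[of 1] above[of 1] by simp
  then show "(\<Sum>a\<in>#A. \<bar>a\<bar>) \<le> (\<Sum>b\<in>#B. \<bar>b\<bar>)"
    using pi_gt_zero by (auto simp: zero_le_mult_iff)
  assume ne: "\<And>x. x > 0 \<Longrightarrow> (\<Prod>a\<in>#A. x\<^sup>2 + a\<^sup>2) \<noteq> (\<Prod>b\<in>#B. x\<^sup>2 + b\<^sup>2)"
  have D'_pos: "D' x > 0" if "x > 0" for x
    using le[OF that] ne[OF that] prod_pos[OF that] by (simp add: D'_def)
  have "D 1 < D 2"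
  proof (rule DERIV_pos_imp_increasing[of 1 2 D])
    fix z :: real assume "1 \<le> z" "z \<le> 2"
    then show "\<exists>d. (D has_real_derivative d) (at z) \<and> 0 < d"
      using deriv[of z] D'_pos[of z] by (intro exI[of _ "D' z"]) auto
  qed simp
  then have "0 < pi * ((\<Sum>b\<in>#B. \<bar>b\<bar>) - (\<Sum>a\<in>#A. \<bar>a\<bar>))"
    using nonneg[of 1] above[of 2] by simp
  then show "(\<Sum>a\<in>#A. \<bar>a\<bar>) < (\<Sum>b\<in>#B. \<bar>b\<bar>)" using pi_gt_zero by (auto simp: zero_less_mult_iff)
qed

section \<open>Hermitian matrices\<close>

definition hermitian :: "nat \<Rightarrow> complex mat \<Rightarrow> bool" where
  "hermitian n A \<longleftrightarrow> A \<in> carrier_mat n n \<and> (\<forall>i<n. \<forall>j<n. A $$ (j, i) = cnj (A $$ (i, j)))"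

lemma hermitian_eigenvalue_real:
  assumes "hermitian n A" "eigenvalue A \<mu>"
  shows "\<mu> \<in> \<real>"
proof -
  have A: "A \<in> carrier_mat n n" and herm: "\<And>i j. i < n \<Longrightarrow> j < n \<Longrightarrow> A $$ (j, i) = cnj (A $$ (i, j))"
    using \<open>hermitian n A\<close> unfolding hermitian_def by blast+
  from \<open>eigenvalue A \<mu>\<close> obtain v where v: "v \<in> carrier_vec n" "v \<noteq> 0\<^sub>v n" "A *\<^sub>v v = \<mu> \<cdot>\<^sub>v v"
    unfolding eigenvalue_def eigenvector_def carrier_matD(1)[OF A] by blast
  have Av: "(\<Sum>j<n. A $$ (i, j) * v $ j) = \<mu> * v $ i" if "i < n" for i
  proof -
    have "(A *\<^sub>v v) $ i = (\<Sum>j<n. A $$ (i, j) * v $ j)"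
      using A v(1) that by (auto simp: scalar_prod_def atLeast0LessThan intro!: sum.cong)
    moreover have "(A *\<^sub>v v) $ i = \<mu> * v $ i" unfolding v(3) using v(1) that by simp
    ultimately show ?thesis by simp
  qed
  define S where "S = (\<Sum>i<n. cnj (v $ i) * v $ i)"
  define T where "T = (\<Sum>i<n. \<Sum>j<n. cnj (v $ i) * A $$ (i, j) * v $ j)"
  have "(\<Sum>j<n. cnj (v $ i) * A $$ (i, j) * v $ j) = \<mu> * (cnj (v $ i) * v $ i)" if "i < n" for i
    using Av[OF that] by (simp add: mult.assoc mult.left_commute flip: sum_distrib_left)
  then have T: "T = \<mu> * S"
    unfolding T_def S_def sum_distrib_left by (intro sum.cong refl) simp
  have "cnj T = (\<Sum>i<n. \<Sum>j<n. cnj (v $ j) * A $$ (j, i) * v $ i)"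
    unfolding T_def cnj_sum by (intro sum.cong refl) (simp add: herm[symmetric])
  also have "\<dots> = T"
    unfolding T_def by (rule sum.swap)
  finally have cT: "cnj T = T" .
  have cS: "cnj S = S" unfolding S_def by (simp add: mult.commute)
  have S_eq: "S = of_real (\<Sum>i<n. (cmod (v $ i))\<^sup>2)"
    unfolding S_def by (simp only: of_real_sum complex_norm_square mult.commute)
  have "S \<noteq> 0"
  proof
    assume "S = 0"
    then have "(\<Sum>i<n. (cmod (v $ i))\<^sup>2) = 0" using S_eq of_real_eq_0_iff by metis
    then have "\<forall>i<n. v $ i = 0" by (simp add: sum_nonneg_eq_0_iff)
    then show False using v by (auto intro!: eq_vecI)
  qed
  then have "cnj \<mu> = \<mu>" using cT cS T by (metis complex_cnj_mult mult_cancel_right)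
  then show ?thesis by (simp add: Reals_cnj_iff)
qed

definition spectrum_mset :: "complex mat \<Rightarrow> real multiset" where
  "spectrum_mset A = image_mset Re (proots (char_poly A))"

lemma hermitian_proots_eq:
  assumes "hermitian n A"
  shows "proots (char_poly A) = image_mset of_real (spectrum_mset A)"
proof -
  have A: "A \<in> carrier_mat n n" using assms by (simp add: hermitian_def)
  have ne: "char_poly A \<noteq> 0" using degree_monic_char_poly[OF A] by auto
  have "image_mset (of_real \<circ> Re) (proots (char_poly A)) = image_mset id (proots (char_poly A))"
  proof (rule image_mset_cong)
    fix \<mu> assume "\<mu> \<in># proots (char_poly A)"
    then have "eigenvalue A \<mu>" using ne by (simp add: eigenvalue_root_char_poly[OF A])
    from hermitian_eigenvalue_real[OF assms this] show "(of_real \<circ> Re) \<mu> = id \<mu>" by simp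
  qed
  then show ?thesis by (simp add: multiset.map_comp spectrum_mset_def)
qed

lemma hermitian_energy:
  assumes "hermitian n A"
  shows "mat_energy A = (\<Sum>a\<in>#spectrum_mset A. \<bar>a\<bar>)"
  unfolding mat_energy_def hermitian_proots_eq[OF assms] by (simp add: multiset.map_comp o_def)

lemma hermitian_char_poly_imaginary:
  assumes "hermitian n A"
  shows "(cmod (poly (char_poly A) (\<i> * of_real y)))\<^sup>2 = (\<Prod>a\<in>#spectrum_mset A. y\<^sup>2 + a\<^sup>2)"
proof -
  have A: "A \<in> carrier_mat n n" using assms by (simp add: hermitian_def)
  have monic: "lead_coeff (char_poly A) = 1" using degree_monic_char_poly[OF A] by auto
  have "char_poly A = (\<Prod>x\<in>#proots (char_poly A). [:-x, 1:])"
    using complex_poly_decompose_multiset[of "char_poly A"] monic by simp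
  then have eq: "char_poly A = (\<Prod>a\<in>#spectrum_mset A. [:- of_real a, 1:])"
    unfolding hermitian_proots_eq[OF assms] by (simp add: multiset.map_comp o_def)
  have factor: "(cmod (\<i> * of_real y - of_real a))\<^sup>2 = y\<^sup>2 + a\<^sup>2" for a
    by (simp add: cmod_power2)
  have "poly (\<Prod>a\<in>#R. [:- of_real a, 1:]) z = (\<Prod>a\<in>#R. z - of_real a)" for R and z :: complex
    by (induction R) (simp_all add: algebra_simps)
  moreover have "(cmod (\<Prod>a\<in>#R. \<i> * of_real y - of_real a))\<^sup>2 = (\<Prod>a\<in>#R. y\<^sup>2 + a\<^sup>2)" for R
    by (induction R) (simp_all add: norm_mult power_mult_distrib factor)
  ultimately have "(cmod (poly (\<Prod>a\<in>#R. [:- of_real a, 1:]) (\<i> * of_real y)))\<^sup>2 = (\<Prod>a\<in>#R. y\<^sup>2 + a\<^sup>2)" for R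
    by simp
  then show ?thesis unfolding eq .
qed

lemma hermitian_size:
  assumes "hermitian n A"
  shows "size (spectrum_mset A) = n"
  using degree_monic_char_poly[of A n] assms
  by (simp add: size_proots_complex spectrum_mset_def hermitian_def)

lemma hermitian_energy_compare:
  assumes A: "hermitian n A" and B: "hermitian n B"
  shows "(\<And>y. y > 0 \<Longrightarrow> cmod (poly (char_poly A) (\<i> * of_real y)) = cmod (poly (char_poly B) (\<i> * of_real y)))
      \<Longrightarrow> mat_energy A = mat_energy B"
    and "(\<And>y. y > 0 \<Longrightarrow> cmod (poly (char_poly A) (\<i> * of_real y)) < cmod (poly (char_poly B) (\<i> * of_real y)))
      \<Longrightarrow> mat_energy A < mat_energy B"
proof -
  note sizes = hermitian_size[OF A] hermitian_size[OF B]
  note prods = hermitian_char_poly_imaginary[OF A, symmetric]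
    hermitian_char_poly_imaginary[OF B, symmetric]
  note energies = hermitian_energy[OF A] hermitian_energy[OF B]
  show "mat_energy A = mat_energy B"
    if "\<And>y. y > 0 \<Longrightarrow> cmod (poly (char_poly A) (\<i> * of_real y)) = cmod (poly (char_poly B) (\<i> * of_real y))"
    unfolding energies
    by (rule antisym; rule sum_abs_compare(1)) (simp_all only: sizes prods that order_refl)
  show "mat_energy A < mat_energy B"
    if "\<And>y. y > 0 \<Longrightarrow> cmod (poly (char_poly A) (\<i> * of_real y)) < cmod (poly (char_poly B) (\<i> * of_real y))"
    unfolding energies
  proof (rule sum_abs_compare(2))
    fix y :: real assume "y > 0"
    from power_strict_mono[OF that[OF this] norm_ge_zero, of 2]
    have less: "(\<Prod>a\<in>#spectrum_mset A. y\<^sup>2 + a\<^sup>2) < (\<Prod>a\<in>#spectrum_mset B. y\<^sup>2 + a\<^sup>2)"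
      unfolding prods by simp
    from less show "(\<Prod>a\<in>#spectrum_mset A. y\<^sup>2 + a\<^sup>2) \<le> (\<Prod>a\<in>#spectrum_mset B. y\<^sup>2 + a\<^sup>2)" by simp
    from less show "(\<Prod>a\<in>#spectrum_mset A. y\<^sup>2 + a\<^sup>2) \<noteq> (\<Prod>a\<in>#spectrum_mset B. y\<^sup>2 + a\<^sup>2)" by simp
  qed (simp only: sizes)
qed

lemma det_list_indexed:
  fixes h :: "'b \<Rightarrow> 'b \<Rightarrow> 'a :: comm_ring_1"
  assumes "distinct vs"
  shows "det (mat (length vs) (length vs) (\<lambda>(i, j). h (vs ! i) (vs ! j))) =
    (\<Sum>\<sigma> | \<sigma> permutes set vs. of_int (sign \<sigma>) * (\<Prod>v\<in>set vs. h v (\<sigma> v)))"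
proof -
  define n where "n = length vs"
  let ?I = "{0..<n}" and ?m = "map_permutation {0..<n} ((!) vs)"
  have bij: "bij_betw ((!) vs) ?I (set vs)"
    using assms by (intro bij_betw_nth) (auto simp: n_def)
  then have inj: "inj_on ((!) vs) ?I" by (rule bij_betw_imp_inj_on)
  have "bij_betw (\<lambda>\<pi> x. if x \<in> set vs then vs ! \<pi> (inv_into ?I ((!) vs) x) else x)
      {\<pi>. \<pi> permutes ?I} {\<pi>. \<pi> permutes set vs}"
    by (rule bij_betw_permutations[OF bij])
  also have "(\<lambda>\<pi> x. if x \<in> set vs then vs ! \<pi> (inv_into ?I ((!) vs) x) else x) = ?m"
    using bij by (auto simp: map_permutation_def restrict_id_def bij_betw_def fun_eq_iff)
  finally have bij_m: "bij_betw ?m {\<pi>. \<pi> permutes ?I} {\<pi>. \<pi> permutes set vs}" .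
  have "(\<Sum>\<sigma> | \<sigma> permutes set vs. of_int (sign \<sigma>) * (\<Prod>v\<in>set vs. h v (\<sigma> v))) =
    (\<Sum>\<pi> | \<pi> permutes ?I. of_int (sign (?m \<pi>)) * (\<Prod>v\<in>set vs. h v (?m \<pi> v)))"
    by (rule sum.reindex_bij_betw[OF bij_m, symmetric])
  also have "\<dots> = (\<Sum>\<pi> | \<pi> permutes ?I. of_int (sign \<pi>) * (\<Prod>i\<in>?I. h (vs ! i) (vs ! \<pi> i)))"
  proof (intro sum.cong refl)
    fix \<pi> assume "\<pi> \<in> {\<pi>. \<pi> permutes ?I}"
    then have "sign (?m \<pi>) = sign \<pi>" by (intro sign_map_permutation inj) auto
    moreover have "(\<Prod>v\<in>set vs. h v (?m \<pi> v)) = (\<Prod>i\<in>?I. h (vs ! i) (?m \<pi> (vs ! i)))"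
      by (rule prod.reindex_bij_betw[OF bij, symmetric])
    ultimately show "of_int (sign (?m \<pi>)) * (\<Prod>v\<in>set vs. h v (?m \<pi> v)) =
        of_int (sign \<pi>) * (\<Prod>i\<in>?I. h (vs ! i) (vs ! \<pi> i))"
      by (simp add: map_permutation_apply[OF inj])
  qed
  also have "\<dots> = det (mat n n (\<lambda>(i, j). h (vs ! i) (vs ! j)))"
  proof -
    have "\<pi> i < n" if "\<pi> permutes ?I" "i < n" for \<pi> i
      using permutes_in_image[OF that(1), of i] that(2) by simp
    then show ?thesis unfolding det_def by (auto intro!: sum.cong prod.cong)
  qed
  finally show ?thesis unfolding n_def by simp
qed

lemma char_poly_list_indexed:
  fixes h :: "'b \<Rightarrow> 'b \<Rightarrow> 'a :: field"
  assumes "distinct vs" and "\<And>v. v \<in> set vs \<Longrightarrow> h v v = 0"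
  shows "poly (char_poly (mat (length vs) (length vs) (\<lambda>(i, j). h (vs ! i) (vs ! j)))) z =
    (\<Sum>\<sigma> | \<sigma> permutes set vs. of_int (sign \<sigma>) * (\<Prod>v\<in>set vs. if \<sigma> v = v then z else - h v (\<sigma> v)))"
proof -
  let ?A = "mat (length vs) (length vs) (\<lambda>(i, j). h (vs ! i) (vs ! j))"
  have "poly (char_poly ?A) z = det (- char_matrix ?A z)"
    by (rule char_poly_matrix[of _ "length vs"]) simp
  also have "- char_matrix ?A z = mat (length vs) (length vs)
      (\<lambda>(i, j). (\<lambda>u v. if v = u then z else - h u v) (vs ! i) (vs ! j))"
    using assms by (intro eq_matI) (auto simp: char_matrix_def nth_eq_iff_index_eq)
  finally show ?thesis
    unfolding det_list_indexed[OF assms(1), of "\<lambda>u v. if v = u then z else - h u v"] .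
qed

section \<open>Cycles of graphs and of permutations\<close>

definition cyclic_arcs :: "'b list \<Rightarrow> ('b \<times> 'b) list" where
  "cyclic_arcs xs = zip xs (rotate1 xs)"

lemma cyclic_arcs_conv:
  assumes "distinct xs"
  shows "cyclic_arcs xs = map (\<lambda>x. (x, cycle_of_list xs x)) xs"
proof -
  have "rotate1 xs = map (cycle_of_list xs) xs"
    using cyclic_rotation[OF assms, of 1] by simp
  then show ?thesis by (simp add: cyclic_arcs_def zip_map2 zip_same_conv_map)
qed

lemma walk_gain_cyclic_arcs:
  assumes "distinct xs"
  shows "walk_gain f (cyclic_arcs xs) = (\<Prod>x\<in>set xs. f (x, cycle_of_list xs x))"
  using assms
  by (simp add: walk_gain_def cyclic_arcs_conv prod.distinct_set_conv_list o_def)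

lemma Union_undirected_edges_cyclic_arcs: "\<Union> (undirected_edges (cyclic_arcs xs)) = set xs"
proof (intro equalityI subsetI)
  fix x assume "x \<in> \<Union> (undirected_edges (cyclic_arcs xs))"
  then obtain u v where "(u, v) \<in> set (zip xs (rotate1 xs))" "x = u \<or> x = v"
    by (auto simp: undirected_edges_def cyclic_arcs_def)
  then show "x \<in> set xs" by (auto dest: set_zip_leftD set_zip_rightD)
next
  fix x assume "x \<in> set xs"
  then have "x \<in> set (map fst (cyclic_arcs xs))" by (simp add: cyclic_arcs_def)
  then obtain v where "(x, v) \<in> set (cyclic_arcs xs)" by auto
  then show "x \<in> \<Union> (undirected_edges (cyclic_arcs xs))"
    unfolding undirected_edges_def by (intro UnionI[of "{x, v}"]) force+
qed

lemma pcas_imp_rotate1: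
  assumes "pcas u p v" "p \<noteq> []"
  shows "fst (hd p) = u \<and> map snd p = tl (map fst p) @ [v]"
  using assms
proof (induction p arbitrary: u)
  case (Cons e p)
  then show ?case by (cases p) auto
qed simp

lemma pcas_zip: "pcas x (zip (x # ys) (ys @ [z])) z"
  by (induction ys arbitrary: x) auto

lemma graph_cycle_iff:
  assumes "pair_wf_digraph G"
  shows "graph_cycle G p \<longleftrightarrow>
    (\<exists>xs. distinct xs \<and> 3 \<le> length xs \<and> p = cyclic_arcs xs \<and> set p \<subseteq> parcs G)"
proof -
  interpret pair_wf_digraph G by fact
  show ?thesis
  proof
    assume "graph_cycle G p"
    then obtain u where len: "3 \<le> length p" and p: "set p \<subseteq> parcs G" "pcas u p u"
      and dist: "distinct (tl (pawalk_verts u p))"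
      unfolding graph_cycle_def cycle_def awalk_def by auto
    let ?xs = "map fst p"
    have "p \<noteq> []" using len by auto
    have snd: "map snd p = tl ?xs @ [u]" and "fst (hd p) = u"
      using pcas_imp_rotate1[OF p(2) \<open>p \<noteq> []\<close>] by auto
    then have rot: "map snd p = rotate1 ?xs"
      using \<open>p \<noteq> []\<close> by (cases p) auto
    have "tl (pawalk_verts u p) = map snd p"
      using awalk_verts_conv'[of u p u] p \<open>p \<noteq> []\<close> by (simp add: cas_with_proj_eq)
    then have "distinct ?xs" using dist rot by (metis distinct1_rotate)
    moreover have "p = cyclic_arcs ?xs"
      unfolding cyclic_arcs_def rot[symmetric] by (simp add: zip_map_fst_snd)
    ultimately show "\<exists>xs. distinct xs \<and> 3 \<le> length xs \<and> p = cyclic_arcs xs \<and> set p \<subseteq> parcs G"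
      using len p by (intro exI[of _ ?xs]) auto
  next
    assume "\<exists>xs. distinct xs \<and> 3 \<le> length xs \<and> p = cyclic_arcs xs \<and> set p \<subseteq> parcs G"
    then obtain xs where xs: "distinct xs" "3 \<le> length xs" "p = cyclic_arcs xs" "set p \<subseteq> parcs G"
      by blast
    then obtain x ys where xs_eq: "xs = x # ys" by (cases xs) auto
    have p_eq: "p = zip (x # ys) (ys @ [x])" using xs by (simp add: cyclic_arcs_def xs_eq)
    then have cas: "pcas x p x" by (simp add: pcas_zip del: zip_Cons_Cons)
    have "p \<noteq> []" using xs by (auto simp: cyclic_arcs_def)
    have "map snd p = ys @ [x]" unfolding p_eq by simp
    moreover have "tl (pawalk_verts x p) = map snd p"
      using awalk_verts_conv'[of x p x] cas \<open>p \<noteq> []\<close> by (simp add: cas_with_proj_eq)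
    ultimately have "distinct (tl (pawalk_verts x p))" using xs by (auto simp: xs_eq)
    moreover have "x \<in> pverts G"
    proof -
      have "hd p \<in> set p" "fst (hd p) = x" using \<open>p \<noteq> []\<close> p_eq by (cases ys; simp)+
      then show ?thesis using xs(4) arc_fst_in_verts by blast
    qed
    ultimately show "graph_cycle G p"
      using xs cas \<open>p \<noteq> []\<close> unfolding graph_cycle_def cycle_def awalk_def
      by (auto simp: cyclic_arcs_def)
  qed
qed

lemma cycle_of_list_funpow_nth:
  assumes "distinct xs" "i < length xs"
  shows "(cycle_of_list xs ^^ k) (xs ! i) = xs ! ((k + i) mod length xs)"
  using cyclic_rotation[OF assms(1), of k] nth_rotate[OF assms(2), of k] assms(2)
  by (metis nth_map)

lemma cycle_of_list_transitive:
  assumes "distinct xs" "x \<in> set xs" "y \<in> set xs"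
  obtains k where "y = (cycle_of_list xs ^^ k) x"
proof -
  from assms obtain i j where ij: "i < length xs" "x = xs ! i" "j < length xs" "y = xs ! j"
    by (auto simp: in_set_conv_nth)
  then have "(cycle_of_list xs ^^ (j + (length xs - i))) x = y"
    using cycle_of_list_funpow_nth[OF assms(1) ij(1), of "j + (length xs - i)"] by simp
  then show ?thesis using that by blast
qed

lemma cycle_of_list_twice_neq:
  assumes "distinct xs" "3 \<le> length xs" "x \<in> set xs"
  shows "cycle_of_list xs (cycle_of_list xs x) \<noteq> x"
proof
  assume eq: "cycle_of_list xs (cycle_of_list xs x) = x"
  from assms obtain i where i: "i < length xs" "x = xs ! i"
    by (auto simp: in_set_conv_nth)
  have "(cycle_of_list xs ^^ 2) x = xs ! ((2 + i) mod length xs)"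
    using cycle_of_list_funpow_nth[OF assms(1) i(1), of 2] i by simp
  then have "xs ! ((2 + i) mod length xs) = xs ! i"
    using eq i by (simp add: numeral_2_eq_2)
  moreover have "(2 + i) mod length xs < length xs" using i by (intro mod_less_divisor) auto
  ultimately have "(2 + i) mod length xs = i"
    using assms(1) i by (simp add: nth_eq_iff_index_eq)
  then show False using assms(2) i(1)
    by (cases "2 + i < length xs") (auto simp: mod_if split: if_splits)
qed

lemma sign_cycle_of_list:
  assumes "distinct xs" "xs \<noteq> []"
  shows "sign (cycle_of_list xs) = (-1) ^ (length xs - 1)"
  using assms
proof (induction xs rule: cycle_of_list.induct)
  case (1 i j cs)
  have "sign (cycle_of_list (i # j # cs)) = sign (transpose i j) * sign (cycle_of_list (j # cs))"
    unfolding cycle_of_list.simps(1)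
    by (intro sign_compose permutation_swap_id permutation_of_cycle)
  then show ?case using 1 by (simp add: sign_swap_id del: cycle_of_list.simps)
qed auto

lemma same_undirected_cycle:
  assumes xs: "distinct xs" "3 \<le> length xs" and ys: "distinct ys" "3 \<le> length ys"
    and same: "undirected_edges (cyclic_arcs xs) = undirected_edges (cyclic_arcs ys)"
  shows "set xs = set ys"
    and "cycle_of_list ys = cycle_of_list xs \<or> cycle_of_list ys = Hilbert_Choice.inv (cycle_of_list xs)"
proof -
  show sets: "set xs = set ys"
    using arg_cong[OF same, of Union] by (simp add: Union_undirected_edges_cyclic_arcs)
  define s t where "s = cycle_of_list xs" and "t = cycle_of_list ys"
  have s_perm: "s permutes set xs" and t_perm: "t permutes set xs"
    using cycle_permutes[of xs] cycle_permutes[of ys] sets by (simp_all add: s_def t_def)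
  have edges: "undirected_edges (cyclic_arcs xs) = (\<lambda>x. {x, s x}) ` set xs"
    "undirected_edges (cyclic_arcs ys) = (\<lambda>x. {x, t x}) ` set xs"
    using xs ys by (auto simp: undirected_edges_def cyclic_arcs_conv s_def t_def sets image_image)
  have alt: "t x = s x \<or> s (t x) = x" if "x \<in> set xs" for x
  proof -
    have "{x, t x} \<in> (\<lambda>x. {x, s x}) ` set xs" using same edges that by blast
    then show ?thesis by (auto simp: doubleton_eq_iff)
  qed
  have twice: "t (t x) \<noteq> x" if "x \<in> set xs" for x
    using cycle_of_list_twice_neq[OF ys] that sets by (simp add: t_def)
  have s_inj: "s x = s y \<Longrightarrow> x = y" for x y using permutes_inj[OF s_perm] by (simp add: inj_eq)
  have outside: "t x = s x" "t x = Hilbert_Choice.inv s x" if "x \<notin> set xs" for x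
    using that s_perm t_perm permutes_inv[OF s_perm] by (simp_all add: permutes_not_in)
  show "t = s \<or> t = Hilbert_Choice.inv s" unfolding s_def[symmetric] t_def[symmetric]
  proof (cases "\<exists>x\<in>set xs. t x = s x")
    case True
    then obtain x where x: "x \<in> set xs" "t x = s x" by blast
    have step: "t (s w) = s (s w)" if "w \<in> set xs" "t w = s w" for w
    proof -
      have "s w \<in> set xs" using that s_perm by (simp add: permutes_in_image)
      from alt[OF this] show ?thesis
        using twice[OF that(1)] that(2) s_inj by metis
    qed
    have in_set: "(s ^^ k) x \<in> set xs" for k
      using x(1) s_perm by (induction k) (simp_all add: permutes_in_image)
    have "t ((s ^^ k) x) = s ((s ^^ k) x)" for k
      by (induction k) (use x step in_set in auto)
    then have "t y = s y" if "y \<in> set xs" for y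
      using cycle_of_list_transitive[OF xs(1) x(1) that] unfolding s_def[symmetric] by metis
    then have "t = s" using outside(1) by blast
    then show ?thesis ..
  next
    case False
    then have "s (t x) = x" if "x \<in> set xs" for x using alt that by blast
    then have "t x = Hilbert_Choice.inv s x" if "x \<in> set xs" for x
      using that permutes_inverses(2)[OF s_perm] by metis
    then have "t = Hilbert_Choice.inv s" using outside(2) by blast
    then show ?thesis ..
  qed
qed

lemma support_long_orbit:
  assumes \<sigma>: "permutation \<sigma>" and x: "\<sigma> (\<sigma> x) \<noteq> x"
  shows "distinct (support \<sigma> x)" and "3 \<le> length (support \<sigma> x)" and "x \<in> set (support \<sigma> x)"
    and "cyclic_arcs (support \<sigma> x) = map (\<lambda>y. (y, \<sigma> y)) (support \<sigma> x)"
    and "\<And>y. y \<in> set (support \<sigma> x) \<Longrightarrow> \<sigma> (\<sigma> y) \<noteq> y"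
proof -
  show d: "distinct (support \<sigma> x)" by (rule cycle_of_permutation[OF \<sigma>])
  note lp = least_power_of_permutation[OF \<sigma>, of x]
  have "least_power \<sigma> x \<noteq> 1" "least_power \<sigma> x \<noteq> 2"
    using lp x by (auto simp: numeral_2_eq_2)
  then show "3 \<le> length (support \<sigma> x)" using lp by auto
  have range: "set (support \<sigma> x) = range (\<lambda>i. (\<sigma> ^^ i) x)" by (rule support_set[OF \<sigma>])
  show "x \<in> set (support \<sigma> x)" unfolding range by (rule range_eqI[of _ _ 0]) simp
  show "cyclic_arcs (support \<sigma> x) = map (\<lambda>y. (y, \<sigma> y)) (support \<sigma> x)"
    unfolding cyclic_arcs_conv[OF d] using cycle_restrict[OF \<sigma>, of _ x] by (intro map_cong refl) simp
  show "\<sigma> (\<sigma> y) \<noteq> y" if "y \<in> set (support \<sigma> x)" for y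
  proof
    assume eq: "\<sigma> (\<sigma> y) = y"
    from that[unfolded range] obtain i where "y = (\<sigma> ^^ i) x" by (rule rangeE)
    then have "(\<sigma> ^^ i) (\<sigma> (\<sigma> x)) = (\<sigma> ^^ i) x"
      using eq by (metis comp_apply funpow_swap1)
    moreover have "inj (\<sigma> ^^ i)"
      using \<sigma> by (intro inj_fn) (simp add: permutation bij_is_inj)
    ultimately show False using x by (simp add: inj_eq)
  qed
qed

lemma involution_weight:
  fixes b :: "'b \<Rightarrow> complex" and z :: complex
  assumes "finite V" and "\<tau> permutes V" and "\<And>x. \<tau> (\<tau> x) = x"
    and "\<And>x. x \<in> V \<Longrightarrow> \<tau> x \<noteq> x \<Longrightarrow> b x * b (\<tau> x) = 1"
  shows "of_int (sign \<tau>) * (\<Prod>x\<in>V. if \<tau> x = x then \<i> * z else b x) =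
    \<i> ^ card V * z ^ card {x \<in> V. \<tau> x = x}"
  using assms
proof (induction V arbitrary: \<tau> rule: finite_psubset_induct)
  case (psubset V)
  show ?case
  proof (cases "\<exists>x\<in>V. \<tau> x \<noteq> x")
    case False
    then have "\<tau> x = x" for x using psubset.prems(1) by (cases "x \<in> V") (auto simp: permutes_not_in)
    then have "\<tau> = id" by auto
    then show ?thesis by (simp add: power_mult_distrib)
  next
    case True
    then obtain x where x: "x \<in> V" "\<tau> x \<noteq> x" by blast
    define W where "W = V - {x, \<tau> x}"
    define \<tau>' where "\<tau>' = \<tau> \<circ> transpose x (\<tau> x)"
    note inv = psubset.prems(2)
    have \<tau>x: "\<tau> x \<in> V" using x psubset.prems(1) by (simp add: permutes_in_image)
    have V: "V = insert x (insert (\<tau> x) W)" using x \<tau>x by (auto simp: W_def)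
    have W: "finite W" "x \<notin> W" "\<tau> x \<notin> W" "W \<subset> V" using psubset.hyps x by (auto simp: W_def)
    have \<tau>'_simps: "\<tau>' x = x" "\<tau>' (\<tau> x) = \<tau> x" "\<And>y. y \<noteq> x \<Longrightarrow> y \<noteq> \<tau> x \<Longrightarrow> \<tau>' y = \<tau> y"
      using inv by (simp_all add: \<tau>'_def)
    then have \<tau>'_W: "\<tau>' y = \<tau> y" if "y \<in> W" for y using that by (auto simp: W_def)
    have "\<tau>' permutes V" unfolding \<tau>'_def
      by (intro permutes_compose permutes_swap_id psubset.prems(1) x \<tau>x)
    then have perm: "\<tau>' permutes W"
      by (rule permutes_superset) (auto simp: W_def \<tau>'_simps)
    have invol: "\<tau>' (\<tau>' y) = y" for y
    proof (cases "y = x \<or> y = \<tau> x")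
      case True
      then show ?thesis using \<tau>'_simps(1,2) by auto
    next
      case False
      then have "\<tau> y \<noteq> x" "\<tau> y \<noteq> \<tau> x" using inv[of y] inv[of x] by metis+
      then show ?thesis using False \<tau>'_simps(3)[of y] \<tau>'_simps(3)[of "\<tau> y"] inv[of y] by simp
    qed
    have sign: "sign \<tau>' = - sign \<tau>"
      unfolding \<tau>'_def using x permutes_imp_permutation[OF psubset.hyps psubset.prems(1)]
      by (simp add: sign_compose permutation_swap_id sign_swap_id)
    have "of_int (sign \<tau>') * (\<Prod>y\<in>W. if \<tau>' y = y then \<i> * z else b y) =
      \<i> ^ card W * z ^ card {y \<in> W. \<tau>' y = y}"
      by (rule psubset.IH[OF \<open>W \<subset> V\<close> perm invol])
        (use psubset.prems(3) \<tau>'_W W in \<open>auto simp: psubset_eq\<close>)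
    moreover have "(\<Prod>y\<in>W. if \<tau>' y = y then \<i> * z else b y) = (\<Prod>y\<in>W. if \<tau> y = y then \<i> * z else b y)"
      by (intro prod.cong refl) (simp add: \<tau>'_W)
    moreover have "{y \<in> W. \<tau>' y = y} = {y \<in> V. \<tau> y = y}"
    proof -
      have "{y \<in> W. \<tau>' y = y} = {y \<in> W. \<tau> y = y}" using \<tau>'_W by auto
      also have "\<dots> = {y \<in> V. \<tau> y = y}" unfolding V using x(2) inv[of x] by auto
      finally show ?thesis .
    qed
    moreover have "(\<Prod>y\<in>V. if \<tau> y = y then \<i> * z else b y) = (\<Prod>y\<in>W. if \<tau> y = y then \<i> * z else b y)"
    proof -
      have "(\<Prod>y\<in>V. if \<tau> y = y then \<i> * z else b y) =
          (b x * b (\<tau> x)) * (\<Prod>y\<in>W. if \<tau> y = y then \<i> * z else b y)"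
        unfolding V using W x inv[of x] by (simp add: mult.assoc)
      then show ?thesis using psubset.prems(3)[OF x] by simp
    qed
    moreover have "card V = card W + 2" unfolding V using W x by simp
    ultimately have "- (of_int (sign \<tau>) * (\<Prod>y\<in>V. if \<tau> y = y then \<i> * z else b y)) =
        - (\<i> ^ card V * z ^ card {y \<in> V. \<tau> y = y})"
      by (simp add: sign power_add)
    then show ?thesis by (simp only: neg_equal_iff_equal)
  qed
qed

lemma long_cycle_weight:
  fixes b :: "'b \<Rightarrow> complex" and z :: complex
  assumes V: "finite V" and \<sigma>: "\<sigma> permutes V"
    and xs: "distinct xs" "3 \<le> length xs" "set xs = {x \<in> V. \<sigma> (\<sigma> x) \<noteq> x}"
      "\<And>x. x \<in> set xs \<Longrightarrow> cycle_of_list xs x = \<sigma> x"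
    and b: "\<And>x. x \<in> V \<Longrightarrow> \<sigma> x \<noteq> x \<Longrightarrow> \<sigma> (\<sigma> x) = x \<Longrightarrow> b x * b (\<sigma> x) = 1"
  shows "of_int (sign \<sigma>) * (\<Prod>x\<in>V. if \<sigma> x = x then \<i> * z else b x) =
    - ((\<Prod>x\<in>set xs. - b x) * \<i> ^ (card V - length xs) * z ^ card {x \<in> V. \<sigma> x = x})"
proof -
  define c where "c = cycle_of_list xs"
  define \<tau> where "\<tau> x = (if x \<in> set xs then x else \<sigma> x)" for x
  have c_perm: "c permutes set xs" unfolding c_def by (rule cycle_permutes)
  have sub: "set xs \<subseteq> V" using xs(3) by auto
  have \<sigma>_eq: "\<sigma> = c \<circ> \<tau>"
  proof
    fix x show "\<sigma> x = (c \<circ> \<tau>) x"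
    proof (cases "x \<in> set xs")
      case True
      then show ?thesis by (simp add: \<tau>_def c_def xs(4))
    next
      case False
      moreover have "\<sigma> x \<notin> set xs"
      proof
        assume in_xs: "\<sigma> x \<in> set xs"
        then have "x \<in> V" using sub \<sigma> by (auto simp: permutes_in_image)
        then have "\<sigma> (\<sigma> x) = x" using False xs(3) by simp
        then show False using in_xs xs(3) by simp
      qed
      ultimately show ?thesis using c_perm by (simp add: \<tau>_def permutes_not_in)
    qed
  qed
  have "\<tau> = Hilbert_Choice.inv c \<circ> \<sigma>"
    unfolding \<sigma>_eq using permutes_inv_o(2)[OF c_perm] by (simp add: o_assoc)
  moreover have "c permutes V" using c_perm sub by (rule permutes_subset)
  ultimately have "\<tau> permutes V" using \<sigma> by (simp add: permutes_compose permutes_inv)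
  then have \<tau>_perm: "\<tau> permutes (V - set xs)"
    by (rule permutes_superset) (auto simp: \<tau>_def)
  have invol: "\<tau> (\<tau> x) = x" for x
  proof (cases "x \<in> V - set xs")
    case True
    then have "\<tau> x \<in> V - set xs" using \<tau>_perm by (simp add: permutes_in_image del: Diff_iff)
    then show ?thesis using True xs(3) by (auto simp: \<tau>_def)
  next
    case False
    then show ?thesis using \<tau>_perm by (simp add: permutes_not_in del: Diff_iff)
  qed
  have "of_int (sign \<tau>) * (\<Prod>x\<in>V - set xs. if \<tau> x = x then \<i> * z else b x) =
      \<i> ^ card (V - set xs) * z ^ card {x \<in> V - set xs. \<tau> x = x}"
    by (rule involution_weight[OF _ \<tau>_perm invol]) (use V b xs(3) in \<open>auto simp: \<tau>_def\<close>)
  moreover have "(\<Prod>x\<in>V - set xs. if \<tau> x = x then \<i> * z else b x) =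
      (\<Prod>x\<in>V - set xs. if \<sigma> x = x then \<i> * z else b x)"
    by (intro prod.cong refl) (simp add: \<tau>_def)
  moreover have "{x \<in> V - set xs. \<tau> x = x} = {x \<in> V. \<sigma> x = x}"
    using xs(3) by (auto simp: \<tau>_def)
  moreover have "card (V - set xs) = card V - length xs"
    using xs(1) sub by (simp add: card_Diff_subset distinct_card)
  ultimately have rest: "of_int (sign \<tau>) * (\<Prod>x\<in>V - set xs. if \<sigma> x = x then \<i> * z else b x) =
      \<i> ^ (card V - length xs) * z ^ card {x \<in> V. \<sigma> x = x}" by simp
  have "(\<Prod>x\<in>V. if \<sigma> x = x then \<i> * z else b x) =
      (\<Prod>x\<in>V - set xs. if \<sigma> x = x then \<i> * z else b x) * (\<Prod>x\<in>set xs. if \<sigma> x = x then \<i> * z else b x)"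
    using V sub by (rule prod.subset_diff[rotated])
  also have "(\<Prod>x\<in>set xs. if \<sigma> x = x then \<i> * z else b x) = (\<Prod>x\<in>set xs. b x)"
    using xs(3) by (intro prod.cong refl) auto
  also have "(\<Prod>x\<in>set xs. b x) = (-1) ^ length xs * (\<Prod>x\<in>set xs. - b x)"
    using xs(1) by (simp add: prod_uminus distinct_card flip: power_mult_distrib mult.assoc)
  finally have split: "(\<Prod>x\<in>V. if \<sigma> x = x then \<i> * z else b x) =
      (\<Prod>x\<in>V - set xs. if \<sigma> x = x then \<i> * z else b x) * ((-1) ^ length xs * (\<Prod>x\<in>set xs. - b x))" .
  have "sign \<sigma> = sign c * sign \<tau>"
    unfolding \<sigma>_eq using c_perm \<tau>_perm V
    by (intro sign_compose) (auto simp: permutation_permutes)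
  moreover have "sign c = (-1) ^ (length xs - 1)"
    unfolding c_def using xs(2) by (intro sign_cycle_of_list xs(1)) auto
  ultimately have "of_int (sign \<sigma>) * (\<Prod>x\<in>V. if \<sigma> x = x then \<i> * z else b x) =
     ((-1) ^ (length xs - 1) * (-1) ^ length xs) * ((\<Prod>x\<in>set xs. - b x) *
       (of_int (sign \<tau>) * (\<Prod>x\<in>V - set xs. if \<sigma> x = x then \<i> * z else b x)))"
    unfolding split by (simp add: mult_ac)
  moreover have "(-1) ^ (length xs - 1) * (-1) ^ length xs = (-1 :: complex)"
    using xs(2) by (cases "length xs") (auto simp flip: power_add)
  ultimately have "of_int (sign \<sigma>) * (\<Prod>x\<in>V. if \<sigma> x = x then \<i> * z else b x) =
     - ((\<Prod>x\<in>set xs. - b x) * (of_int (sign \<tau>) * (\<Prod>x\<in>V - set xs. if \<sigma> x = x then \<i> * z else b x)))"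
    by simp
  then show ?thesis unfolding rest by (simp add: mult.assoc)
qed

section \<open>The characteristic polynomial of a unicyclic gain graph\<close>

lemma unicyclic_undirected_edges:
  assumes "unicyclic G" "graph_cycle G p" "graph_cycle G q"
  shows "undirected_edges p = undirected_edges q"
  using assms unfolding unicyclic_def by blast

lemma graph_cycle_length:
  assumes "pair_wf_digraph G" "graph_cycle G p"
  shows "length p = card (\<Union> (undirected_edges p))"
  using assms(2) unfolding graph_cycle_iff[OF assms(1)]
  by (auto simp: Union_undirected_edges_cyclic_arcs distinct_card) (simp add: cyclic_arcs_def)

lemma unicyclic_girth:
  assumes "pair_wf_digraph G" "unicyclic G" "graph_cycle G p"
  shows "girth G = length p"
proof -
  have "\<exists>q. graph_cycle G q \<and> length q = girth G"
    unfolding girth_def by (rule LeastI_ex) (use assms(3) in blast)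
  then obtain q where "graph_cycle G q" "length q = girth G" by blast
  then show ?thesis
    using graph_cycle_length[OF assms(1)] unicyclic_undirected_edges[OF assms(2)] assms(3) by metis
qed

definition supported_perms :: "'a pair_pre_digraph \<Rightarrow> ('a \<Rightarrow> 'a) set" where
  "supported_perms G = {\<sigma>. \<sigma> permutes pverts G \<and> (\<forall>x. \<sigma> x \<noteq> x \<longrightarrow> (x, \<sigma> x) \<in> parcs G)}"

definition fixpoint_count :: "'a pair_pre_digraph \<Rightarrow> ('a \<Rightarrow> 'a) \<Rightarrow> nat" where
  "fixpoint_count G \<sigma> = card {x \<in> pverts G. \<sigma> x = x}"

text \<open>Up to powers of $i$, these are the value at $iy$ of the matching polynomial of $G$ and, if $G$ is
  unicyclic with cycle $C$, twice the value at $iy$ of the matching polynomial of $G - C$.\<close>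

definition matching_sum :: "'a pair_pre_digraph \<Rightarrow> real \<Rightarrow> real" where
  "matching_sum G y =
    (\<Sum>\<sigma> | \<sigma> \<in> supported_perms G \<and> (\<forall>x. \<sigma> (\<sigma> x) = x). y ^ fixpoint_count G \<sigma>)"

definition cycle_sum :: "'a pair_pre_digraph \<Rightarrow> real \<Rightarrow> real" where
  "cycle_sum G y =
    (\<Sum>\<sigma> | \<sigma> \<in> supported_perms G \<and> (\<exists>x. \<sigma> (\<sigma> x) \<noteq> x). y ^ fixpoint_count G \<sigma>)"

lemma finite_supported_perms: "finite (pverts G) \<Longrightarrow> finite (supported_perms G)"
  unfolding supported_perms_def by (rule finite_subset[OF _ finite_permutations]) auto

lemma matching_sum_ge:
  assumes "finite (pverts G)" "y > 0"
  shows "y ^ card (pverts G) \<le> matching_sum G y"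
proof -
  have "id \<in> supported_perms G" "fixpoint_count G id = card (pverts G)"
    by (auto simp: supported_perms_def fixpoint_count_def)
  then show ?thesis unfolding matching_sum_def
    using finite_supported_perms[OF assms(1)] assms(2)
    by (intro order_trans[OF _ member_le_sum[of id]]) auto
qed

lemma cycle_sum_le:
  fixes y :: real
  assumes "finite (pverts G)" "y \<ge> 1"
  shows "cycle_sum G y * y \<le> card (supported_perms G) * y ^ card (pverts G)"
proof -
  let ?J = "{\<sigma>. \<sigma> \<in> supported_perms G \<and> (\<exists>x. \<sigma> (\<sigma> x) \<noteq> x)}"
  have fin: "finite ?J" using finite_supported_perms[OF assms(1)] by simp
  have "y ^ fixpoint_count G \<sigma> * y \<le> y ^ card (pverts G)" if "\<sigma> \<in> ?J" for \<sigma>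
  proof -
    from that obtain x where "\<sigma> (\<sigma> x) \<noteq> x" by (elim CollectE conjE exE)
    then have "\<sigma> x \<noteq> x" by auto
    moreover have "\<sigma> permutes pverts G" using that by (simp add: supported_perms_def)
    ultimately have "x \<in> pverts G" by (meson permutes_not_in)
    then have "{x \<in> pverts G. \<sigma> x = x} \<subset> pverts G" using \<open>\<sigma> x \<noteq> x\<close> by blast
    then have "Suc (fixpoint_count G \<sigma>) \<le> card (pverts G)"
      unfolding fixpoint_count_def using assms(1) by (simp add: Suc_le_eq psubset_card_mono)
    then have "y ^ Suc (fixpoint_count G \<sigma>) \<le> y ^ card (pverts G)"
      using assms(2) by (rule power_increasing)
    then show ?thesis by (simp add: mult.commute)
  qed
  then have "cycle_sum G y * y \<le> card ?J * y ^ card (pverts G)"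
    unfolding cycle_sum_def sum_distrib_right by (rule sum_bounded_above)
  also have "card ?J \<le> card (supported_perms G)"
    using finite_supported_perms[OF assms(1)] by (intro card_mono) auto
  then have "card ?J * y ^ card (pverts G) \<le> card (supported_perms G) * y ^ card (pverts G)"
    using assms(2) by (intro mult_right_mono) auto
  finally show ?thesis .
qed

lemma eventually_cycle_sum_less_matching_sum:
  assumes "finite (pverts G)"
  shows "\<exists>Y\<ge>y. cycle_sum G Y < matching_sum G Y"
proof -
  define Y where "Y = max y (real (card (supported_perms G)) + 1)"
  have Y: "Y \<ge> 1" "Y > card (supported_perms G)" by (auto simp: Y_def)
  have "cycle_sum G Y * Y \<le> card (supported_perms G) * Y ^ card (pverts G)"
    by (rule cycle_sum_le[OF assms Y(1)])
  also have "\<dots> < Y * Y ^ card (pverts G)" using Y by (intro mult_strict_right_mono) auto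
  also have "\<dots> \<le> Y * matching_sum G Y"
    using matching_sum_ge[OF assms, of Y] Y by (intro mult_left_mono) auto
  finally have "cycle_sum G Y < matching_sum G Y" using Y(1) by (simp add: mult.commute)
  moreover have "Y \<ge> y" by (simp add: Y_def)
  ultimately show ?thesis by blast
qed

context gain_graph
begin

lemma arc_sym: "(u, v) \<in> parcs G \<Longrightarrow> (v, u) \<in> parcs G"
  using pair_sym_arcs by (auto simp: symmetric_def dest: symD)

lemma gain_mult_cnj: "e \<in> parcs G \<Longrightarrow> \<phi> e * cnj (\<phi> e) = 1"
  using gain_unit[of e] complex_norm_square[of "\<phi> e"] by simp

lemma gain_cnj: "(u, v) \<in> parcs G \<Longrightarrow> \<phi> (u, v) = cnj (\<phi> (v, u))"
  using gain_reverse[of u v] gain_mult_cnj[OF arc_sym, of u v] by (simp add: inverse_unique)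

lemma gain_mult_reverse: "(u, v) \<in> parcs G \<Longrightarrow> \<phi> (u, v) * \<phi> (v, u) = 1"
  using gain_cnj[OF arc_sym, of u v] gain_mult_cnj[of "(u, v)"] by simp

lemma hermitian_gain_adjacency_mat:
  "hermitian (length vs) (gain_adjacency_mat G \<phi> vs)"
  unfolding hermitian_def gain_adjacency_mat_def
  by (auto dest: arc_sym intro: gain_cnj)

lemma cmod_walk_gain: "set p \<subseteq> parcs G \<Longrightarrow> cmod (walk_gain \<phi> p) = 1"
  unfolding walk_gain_def by (induction p) (auto simp: norm_mult gain_unit)

lemma Re_walk_gain_eq_1_iff:
  assumes "set p \<subseteq> parcs G"
  shows "walk_gain \<phi> p = 1 \<longleftrightarrow> Re (walk_gain \<phi> p) = 1"
    and "walk_gain \<phi> p = -1 \<longleftrightarrow> Re (walk_gain \<phi> p) = -1"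
  using cmod_walk_gain[OF assms] by (auto simp: complex_eq_iff cmod_def)

end

locale unicyclic_gain_graph = gain_graph +
  assumes unicyclic: "unicyclic G"
begin

lemma pair_wf: "pair_wf_digraph G" by unfold_locales

lemma graph_cycle_cyclic_arcs:
  assumes "graph_cycle G p"
  obtains xs where "distinct xs" "3 \<le> length xs" "p = cyclic_arcs xs" "set p \<subseteq> parcs G"
  using assms graph_cycle_iff[OF pair_wf] by blast

lemma Re_walk_gain_cong:
  assumes "graph_cycle G p" "graph_cycle G q"
  shows "Re (walk_gain \<phi> p) = Re (walk_gain \<phi> q)"
proof -
  obtain xs where xs: "distinct xs" "3 \<le> length xs" "p = cyclic_arcs xs" "set p \<subseteq> parcs G"
    using graph_cycle_cyclic_arcs[OF assms(1)] .
  obtain ys where ys: "distinct ys" "3 \<le> length ys" "q = cyclic_arcs ys"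
    using graph_cycle_cyclic_arcs[OF assms(2)] .
  define s where "s = cycle_of_list xs"
  have s: "s permutes set xs" unfolding s_def by (rule cycle_permutes)
  have same: "undirected_edges (cyclic_arcs xs) = undirected_edges (cyclic_arcs ys)"
    using unicyclic_undirected_edges[OF unicyclic assms] xs ys by simp
  have gain_p: "walk_gain \<phi> p = (\<Prod>x\<in>set xs. \<phi> (x, s x))"
    using xs by (simp add: walk_gain_cyclic_arcs s_def)
  have gain_q: "walk_gain \<phi> q = (\<Prod>x\<in>set xs. \<phi> (x, cycle_of_list ys x))"
    using ys same_undirected_cycle(1)[OF xs(1,2) ys(1,2) same] by (simp add: walk_gain_cyclic_arcs)
  consider "cycle_of_list ys = s" | "cycle_of_list ys = Hilbert_Choice.inv s"
    using same_undirected_cycle(2)[OF xs(1,2) ys(1,2) same] unfolding s_def by blast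
  then show ?thesis
  proof cases
    case 1
    then show ?thesis using gain_p gain_q by simp
  next
    case 2
    have arc: "(x, s x) \<in> parcs G" if "x \<in> set xs" for x
      using xs that by (auto simp: cyclic_arcs_conv s_def)
    have "walk_gain \<phi> q = (\<Prod>x\<in>set xs. \<phi> (s x, Hilbert_Choice.inv s (s x)))"
      unfolding gain_q 2 by (subst prod.permute[OF s]) (simp add: o_def)
    also have "\<dots> = (\<Prod>x\<in>set xs. cnj (\<phi> (x, s x)))"
      using permutes_inverses(2)[OF s] gain_cnj[OF arc_sym, OF arc] by (intro prod.cong refl) simp
    also have "\<dots> = cnj (walk_gain \<phi> p)" unfolding gain_p by simp
    finally show ?thesis by simp
  qed
qed

definition long_orbit :: "('a \<Rightarrow> 'a) \<Rightarrow> 'a set" where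
  "long_orbit \<sigma> = {x \<in> pverts G. \<sigma> (\<sigma> x) \<noteq> x}"

lemma supported_perm_long_orbit:
  assumes \<sigma>: "\<sigma> \<in> supported_perms G" and x: "\<sigma> (\<sigma> x) \<noteq> x"
  obtains xs where "distinct xs" "3 \<le> length xs" "set xs = long_orbit \<sigma>"
    "\<And>y. y \<in> set xs \<Longrightarrow> cycle_of_list xs y = \<sigma> y"
    "graph_cycle G (cyclic_arcs xs)"
proof
  have perm: "\<sigma> permutes pverts G" and arc: "\<And>y. \<sigma> y \<noteq> y \<Longrightarrow> (y, \<sigma> y) \<in> parcs G"
    using \<sigma> by (auto simp: supported_perms_def)
  have permutation: "permutation \<sigma>" using perm pair_finite_verts by (rule permutes_imp_permutation[rotated])
  note long = support_long_orbit[OF permutation]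
  have cycle: "graph_cycle G (cyclic_arcs (support \<sigma> y))" if y: "\<sigma> (\<sigma> y) \<noteq> y" for y
  proof -
    have "\<sigma> z \<noteq> z" if "z \<in> set (support \<sigma> y)" for z using long(5)[OF y that] by auto
    then have "set (cyclic_arcs (support \<sigma> y)) \<subseteq> parcs G"
      unfolding long(4)[OF y] using arc by auto
    then show ?thesis using long(1,2)[OF y] graph_cycle_iff[OF pair_wf] by blast
  qed
  show "distinct (support \<sigma> x)" "3 \<le> length (support \<sigma> x)" by (rule long[OF x])+
  show "graph_cycle G (cyclic_arcs (support \<sigma> x))" by (rule cycle[OF x])
  show "cycle_of_list (support \<sigma> x) y = \<sigma> y" if "y \<in> set (support \<sigma> x)" for y
    using cycle_restrict[OF permutation that] by simp
  show "set (support \<sigma> x) = long_orbit \<sigma>"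
  proof (intro equalityI subsetI)
    fix y assume "y \<in> set (support \<sigma> x)"
    from long(5)[OF x this] have y: "\<sigma> (\<sigma> y) \<noteq> y" .
    then have "y \<in> pverts G" using perm by (metis permutes_not_in)
    then show "y \<in> long_orbit \<sigma>" using y by (simp add: long_orbit_def)
  next
    fix y assume "y \<in> long_orbit \<sigma>"
    then have y: "\<sigma> (\<sigma> y) \<noteq> y" by (simp add: long_orbit_def)
    have "set (support \<sigma> x) = set (support \<sigma> y)"
      using unicyclic_undirected_edges[OF unicyclic cycle[OF x] cycle[OF y]]
      by (metis Union_undirected_edges_cyclic_arcs)
    then show "y \<in> set (support \<sigma> x)" using long(3)[OF y] by simp
  qed
qed

definition orbit_gain :: "('a \<Rightarrow> 'a) \<Rightarrow> complex" where
  "orbit_gain \<sigma> = (\<Prod>x\<in>long_orbit \<sigma>. \<phi> (x, \<sigma> x))"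

lemma supported_perm_weight:
  assumes \<sigma>: "\<sigma> \<in> supported_perms G"
  shows "\<forall>x. \<sigma> (\<sigma> x) = x \<Longrightarrow>
      of_int (sign \<sigma>) * (\<Prod>x\<in>pverts G. if \<sigma> x = x then \<i> * z else - \<phi> (x, \<sigma> x)) =
      \<i> ^ card (pverts G) * z ^ fixpoint_count G \<sigma>"
    and "\<sigma> (\<sigma> x) \<noteq> x \<Longrightarrow>
      of_int (sign \<sigma>) * (\<Prod>x\<in>pverts G. if \<sigma> x = x then \<i> * z else - \<phi> (x, \<sigma> x)) =
      - (orbit_gain \<sigma> * \<i> ^ (card (pverts G) - girth G) * z ^ fixpoint_count G \<sigma>)"
proof -
  have perm: "\<sigma> permutes pverts G" and arc: "\<And>y. \<sigma> y \<noteq> y \<Longrightarrow> (y, \<sigma> y) \<in> parcs G"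
    using \<sigma> by (auto simp: supported_perms_def)
  have two: "- \<phi> (x, \<sigma> x) * - \<phi> (\<sigma> x, \<sigma> (\<sigma> x)) = 1" if "\<sigma> x \<noteq> x" "\<sigma> (\<sigma> x) = x" for x
    using gain_mult_reverse[OF arc[OF that(1)]] that(2) by simp
  show "of_int (sign \<sigma>) * (\<Prod>x\<in>pverts G. if \<sigma> x = x then \<i> * z else - \<phi> (x, \<sigma> x)) =
      \<i> ^ card (pverts G) * z ^ fixpoint_count G \<sigma>" if "\<forall>x. \<sigma> (\<sigma> x) = x"
    unfolding fixpoint_count_def
    by (rule involution_weight[OF pair_finite_verts perm]) (use that two in auto)
  show "of_int (sign \<sigma>) * (\<Prod>x\<in>pverts G. if \<sigma> x = x then \<i> * z else - \<phi> (x, \<sigma> x)) =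
      - (orbit_gain \<sigma> * \<i> ^ (card (pverts G) - girth G) * z ^ fixpoint_count G \<sigma>)"
    if long: "\<sigma> (\<sigma> x) \<noteq> x" for x
  proof -
    obtain xs where xs: "distinct xs" "3 \<le> length xs" "set xs = long_orbit \<sigma>"
      "\<And>y. y \<in> set xs \<Longrightarrow> cycle_of_list xs y = \<sigma> y" "graph_cycle G (cyclic_arcs xs)"
      using supported_perm_long_orbit[OF \<sigma> long] by metis
    have "girth G = length xs"
      using unicyclic_girth[OF pair_wf unicyclic xs(5)] by (simp add: cyclic_arcs_def)
    moreover have "of_int (sign \<sigma>) * (\<Prod>x\<in>pverts G. if \<sigma> x = x then \<i> * z else - \<phi> (x, \<sigma> x)) =
      - ((\<Prod>x\<in>set xs. - (- \<phi> (x, \<sigma> x))) * \<i> ^ (card (pverts G) - length xs) *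
        z ^ card {x \<in> pverts G. \<sigma> x = x})"
      using xs(3) unfolding long_orbit_def
      by (intro long_cycle_weight[OF pair_finite_verts perm xs(1,2) _ xs(4)] two)
    ultimately show ?thesis using xs(3) by (simp add: orbit_gain_def fixpoint_count_def)
  qed
qed

lemma Re_orbit_gain:
  assumes "\<sigma> \<in> supported_perms G" "\<sigma> (\<sigma> x) \<noteq> x" "graph_cycle G p"
  shows "Re (orbit_gain \<sigma>) = Re (walk_gain \<phi> p)"
proof -
  obtain xs where xs: "distinct xs" "set xs = long_orbit \<sigma>"
    "\<And>y. y \<in> set xs \<Longrightarrow> cycle_of_list xs y = \<sigma> y" "graph_cycle G (cyclic_arcs xs)"
    using supported_perm_long_orbit[OF assms(1,2)] by metis
  have "orbit_gain \<sigma> = walk_gain \<phi> (cyclic_arcs xs)"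
    unfolding orbit_gain_def walk_gain_cyclic_arcs[OF xs(1)] xs(2)[symmetric]
    by (intro prod.cong refl) (simp add: xs(3))
  then show ?thesis using Re_walk_gain_cong[OF xs(4) assms(3)] by simp
qed

lemma supported_perm_inv:
  assumes "\<sigma> \<in> supported_perms G"
  shows "Hilbert_Choice.inv \<sigma> \<in> supported_perms G"
    and "orbit_gain (Hilbert_Choice.inv \<sigma>) = cnj (orbit_gain \<sigma>)"
    and "fixpoint_count G (Hilbert_Choice.inv \<sigma>) = fixpoint_count G \<sigma>"
    and "Hilbert_Choice.inv \<sigma> (Hilbert_Choice.inv \<sigma> x) = x \<longleftrightarrow> \<sigma> (\<sigma> x) = x"
proof -
  let ?\<tau> = "Hilbert_Choice.inv \<sigma>"
  have perm: "\<sigma> permutes pverts G" and arc: "\<And>y. \<sigma> y \<noteq> y \<Longrightarrow> (y, \<sigma> y) \<in> parcs G"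
    using assms by (auto simp: supported_perms_def)
  note inv = permutes_inverses[OF perm]
  have fixed: "?\<tau> y = y \<longleftrightarrow> \<sigma> y = y" for y using inv by metis
  show twice: "?\<tau> (?\<tau> y) = y \<longleftrightarrow> \<sigma> (\<sigma> y) = y" for y using inv by metis
  show "?\<tau> \<in> supported_perms G"
    unfolding supported_perms_def
  proof (intro CollectI conjI allI impI)
    show "?\<tau> permutes pverts G" by (rule permutes_inv[OF perm])
    fix y assume "?\<tau> y \<noteq> y"
    then have "\<sigma> (?\<tau> y) \<noteq> ?\<tau> y" using inv(1)[of y] by simp
    from arc_sym[OF arc[OF this]] show "(y, ?\<tau> y) \<in> parcs G" using inv(1)[of y] by simp
  qed
  show "fixpoint_count G ?\<tau> = fixpoint_count G \<sigma>" by (simp add: fixpoint_count_def fixed)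
  have "orbit_gain ?\<tau> = (\<Prod>x\<in>long_orbit \<sigma>. \<phi> (x, ?\<tau> x))"
    by (simp add: orbit_gain_def long_orbit_def twice)
  also have "\<dots> = (\<Prod>x\<in>long_orbit \<sigma>. \<phi> (\<sigma> x, x))"
  proof (rule prod.reindex_bij_witness[of _ \<sigma> ?\<tau>])
    fix y assume y: "y \<in> long_orbit \<sigma>"
    show "\<sigma> (?\<tau> y) = y" "?\<tau> (\<sigma> y) = y" using inv by simp_all
    show "\<phi> (\<sigma> (?\<tau> y), ?\<tau> y) = \<phi> (y, ?\<tau> y)" using inv by simp
    have "inj \<sigma>" by (rule permutes_inj[OF perm])
    then show "\<sigma> y \<in> long_orbit \<sigma>"
      using y perm by (auto simp: long_orbit_def permutes_in_image dest: injD)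
    have "?\<tau> y \<in> pverts G"
      using y permutes_inv[OF perm] by (simp add: long_orbit_def permutes_in_image)
    moreover have "\<sigma> (\<sigma> (?\<tau> y)) \<noteq> ?\<tau> y"
    proof
      assume "\<sigma> (\<sigma> (?\<tau> y)) = ?\<tau> y"
      then have "\<sigma> (\<sigma> y) = y" using inv(1)[of y] by simp
      then show False using y by (simp add: long_orbit_def)
    qed
    ultimately show "?\<tau> y \<in> long_orbit \<sigma>" by (simp add: long_orbit_def)
  qed
  also have "\<dots> = (\<Prod>x\<in>long_orbit \<sigma>. cnj (\<phi> (x, \<sigma> x)))"
  proof (intro prod.cong refl)
    fix y assume "y \<in> long_orbit \<sigma>"
    then have "\<sigma> y \<noteq> y" by (auto simp: long_orbit_def)
    then show "\<phi> (\<sigma> y, y) = cnj (\<phi> (y, \<sigma> y))" by (rule gain_cnj[OF arc_sym[OF arc]])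
  qed
  also have "\<dots> = cnj (orbit_gain \<sigma>)" by (simp add: orbit_gain_def)
  finally show "orbit_gain ?\<tau> = cnj (orbit_gain \<sigma>)" .
qed

lemma sum_orbit_gain:
  assumes p: "graph_cycle G p"
  shows "(\<Sum>\<sigma> | \<sigma> \<in> supported_perms G \<and> (\<exists>x. \<sigma> (\<sigma> x) \<noteq> x).
      orbit_gain \<sigma> * of_real (y ^ fixpoint_count G \<sigma>)) =
    of_real (Re (walk_gain \<phi> p) * cycle_sum G y)" (is "?S = _")
proof -
  let ?J = "{\<sigma>. \<sigma> \<in> supported_perms G \<and> (\<exists>x. \<sigma> (\<sigma> x) \<noteq> x)}"
  have inv_inv: "Hilbert_Choice.inv (Hilbert_Choice.inv \<sigma>) = \<sigma>" if "\<sigma> \<in> ?J" for \<sigma>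
    using that by (intro permutes_inv_inv[of _ "pverts G"]) (simp add: supported_perms_def)
  have J_inv: "Hilbert_Choice.inv \<sigma> \<in> ?J" if "\<sigma> \<in> ?J" for \<sigma>
    using that supported_perm_inv(1,4)[of \<sigma>] by auto
  have "?S = (\<Sum>\<sigma>\<in>?J. cnj (orbit_gain \<sigma>) * of_real (y ^ fixpoint_count G \<sigma>))"
  proof (rule sum.reindex_bij_witness[of _ Hilbert_Choice.inv Hilbert_Choice.inv])
    fix \<sigma> assume \<sigma>: "\<sigma> \<in> ?J"
    show "Hilbert_Choice.inv (Hilbert_Choice.inv \<sigma>) = \<sigma>"
      "Hilbert_Choice.inv (Hilbert_Choice.inv \<sigma>) = \<sigma>" by (rule inv_inv[OF \<sigma>])+
    show "Hilbert_Choice.inv \<sigma> \<in> ?J" "Hilbert_Choice.inv \<sigma> \<in> ?J" by (rule J_inv[OF \<sigma>])+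
    show "cnj (orbit_gain (Hilbert_Choice.inv \<sigma>)) *
        of_real (y ^ fixpoint_count G (Hilbert_Choice.inv \<sigma>)) =
        orbit_gain \<sigma> * of_real (y ^ fixpoint_count G \<sigma>)"
      using \<sigma> by (simp add: supported_perm_inv(2,3))
  qed
  also have "\<dots> = cnj ?S" by simp
  finally have "?S \<in> \<real>" unfolding Reals_cnj_iff by (rule sym)
  then have "?S = of_real (Re ?S)" by (simp only: of_real_Re)
  also have "Re ?S = (\<Sum>\<sigma>\<in>?J. Re (orbit_gain \<sigma>) * y ^ fixpoint_count G \<sigma>)"
    by (simp flip: of_real_power)
  also have "\<dots> = (\<Sum>\<sigma>\<in>?J. Re (walk_gain \<phi> p) * y ^ fixpoint_count G \<sigma>)"
    using Re_orbit_gain[OF _ _ p] by (intro sum.cong refl) auto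
  also have "\<dots> = Re (walk_gain \<phi> p) * cycle_sum G y"
    by (simp add: cycle_sum_def sum_distrib_left)
  finally show ?thesis .
qed

lemma char_poly_gain_adjacency_mat:
  assumes vs: "distinct vs" "set vs = pverts G" and p: "graph_cycle G p"
  shows "poly (char_poly (gain_adjacency_mat G \<phi> vs)) (\<i> * of_real y) =
    \<i> ^ card (pverts G) * of_real (matching_sum G y) -
    \<i> ^ (card (pverts G) - girth G) * of_real (Re (walk_gain \<phi> p) * cycle_sum G y)"
proof -
  define h where "h u v = (if (u, v) \<in> parcs G then \<phi> (u, v) else 0)" for u v
  define w where "w \<sigma> = of_int (sign \<sigma>) *
    (\<Prod>v\<in>pverts G. if \<sigma> v = v then \<i> * of_real y else - h v (\<sigma> v))" for \<sigma>
  let ?I = "{\<sigma>. \<sigma> \<in> supported_perms G \<and> (\<forall>x. \<sigma> (\<sigma> x) = x)}"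
  let ?J = "{\<sigma>. \<sigma> \<in> supported_perms G \<and> (\<exists>x. \<sigma> (\<sigma> x) \<noteq> x)}"
  have w_eq: "w \<sigma> = of_int (sign \<sigma>) *
      (\<Prod>v\<in>pverts G. if \<sigma> v = v then \<i> * of_real y else - \<phi> (v, \<sigma> v))"
    if "\<sigma> \<in> supported_perms G" for \<sigma>
    using that unfolding w_def
    by (intro arg_cong[where f = "\<lambda>a. of_int (sign \<sigma>) * a"] prod.cong refl)
      (auto simp: h_def supported_perms_def)
  have w_0: "w \<sigma> = 0" if "\<sigma> permutes pverts G" "\<sigma> \<notin> supported_perms G" for \<sigma>
  proof -
    have "\<exists>x. \<sigma> x \<noteq> x \<and> (x, \<sigma> x) \<notin> parcs G"
      using that by (simp add: supported_perms_def)
    then obtain x where x: "\<sigma> x \<noteq> x" "(x, \<sigma> x) \<notin> parcs G" by (elim exE conjE)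
    then have "x \<in> pverts G" using that(1) by (metis permutes_not_in)
    then show ?thesis
      using x pair_finite_verts unfolding w_def by (auto simp: h_def intro!: bexI[of _ x])
  qed
  have "h v v = 0" for v using pair_no_loops[of "(v, v)"] by (auto simp: h_def)
  then have "poly (char_poly (gain_adjacency_mat G \<phi> vs)) (\<i> * of_real y) =
      (\<Sum>\<sigma> | \<sigma> permutes pverts G. w \<sigma>)"
    using char_poly_list_indexed[OF vs(1), of h "\<i> * of_real y"]
    unfolding vs(2) gain_adjacency_mat_def w_def h_def by simp
  also have "\<dots> = (\<Sum>\<sigma>\<in>supported_perms G. w \<sigma>)"
    using pair_finite_verts w_0
    by (intro sum.mono_neutral_right finite_permutations) (auto simp: supported_perms_def)
  also have "supported_perms G = ?I \<union> ?J" by blast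
  also have "(\<Sum>\<sigma>\<in>?I \<union> ?J. w \<sigma>) = (\<Sum>\<sigma>\<in>?I. w \<sigma>) + (\<Sum>\<sigma>\<in>?J. w \<sigma>)"
    using finite_supported_perms[OF pair_finite_verts] by (intro sum.union_disjoint) auto
  also have "(\<Sum>\<sigma>\<in>?I. w \<sigma>) = \<i> ^ card (pverts G) * of_real (matching_sum G y)"
    unfolding matching_sum_def of_real_sum sum_distrib_left
    by (intro sum.cong refl) (simp add: w_eq supported_perm_weight(1))
  also have "(\<Sum>\<sigma>\<in>?J. w \<sigma>) = - (\<i> ^ (card (pverts G) - girth G) *
      (\<Sum>\<sigma>\<in>?J. orbit_gain \<sigma> * of_real (y ^ fixpoint_count G \<sigma>)))"
    unfolding sum_distrib_left sum_negf[symmetric]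
    by (intro sum.cong refl) (auto simp: w_eq supported_perm_weight(2))
  finally show ?thesis unfolding sum_orbit_gain[OF p] by simp
qed

end

section \<open>Energies\<close>

lemma isCont_matching_sum: "isCont (matching_sum G) y"
  unfolding matching_sum_def[abs_def] by (intro continuous_intros)

lemma isCont_cycle_sum: "isCont (cycle_sum G) y"
  unfolding cycle_sum_def[abs_def] by (intro continuous_intros)

context unicyclic_gain_graph
begin

lemma obtain_graph_cycle:
  obtains p where "graph_cycle G p"
  using unicyclic unfolding unicyclic_def by blast

lemma girth_le: "girth G \<le> card (pverts G)"
proof -
  obtain p where p: "graph_cycle G p" by (rule obtain_graph_cycle)
  obtain xs where xs: "p = cyclic_arcs xs" "set p \<subseteq> parcs G"
    using graph_cycle_cyclic_arcs[OF p] by metis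
  have "\<Union> (undirected_edges p) \<subseteq> pverts G"
    using xs(2) arc_fst_in_verts arc_snd_in_verts by (force simp: undirected_edges_def)
  then have "card (\<Union> (undirected_edges p)) \<le> card (pverts G)"
    by (rule card_mono[OF pair_finite_verts])
  then show ?thesis
    using unicyclic_girth[OF pair_wf unicyclic p] graph_cycle_length[OF pair_wf p] by simp
qed

lemma cycle_sum_pos:
  assumes "y > 0"
  shows "cycle_sum G y > 0"
proof -
  obtain p where p: "graph_cycle G p" by (rule obtain_graph_cycle)
  obtain xs where xs: "distinct xs" "3 \<le> length xs" "p = cyclic_arcs xs" "set p \<subseteq> parcs G"
    using graph_cycle_cyclic_arcs[OF p] .
  define s where "s = cycle_of_list xs"
  have arc: "(x, s x) \<in> parcs G" if "x \<in> set xs" for x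
    using xs that by (auto simp: cyclic_arcs_conv s_def)
  then have "set xs \<subseteq> pverts G" using arc_fst_in_verts by fastforce
  then have "s permutes pverts G"
    unfolding s_def by (rule permutes_subset[OF cycle_permutes])
  moreover have "(x, s x) \<in> parcs G" if "s x \<noteq> x" for x
    using arc[of x] that id_outside_supp[of x xs] unfolding s_def by blast
  ultimately have "s \<in> supported_perms G" by (simp add: supported_perms_def)
  moreover have "s (s (hd xs)) \<noteq> hd xs"
    unfolding s_def using xs by (intro cycle_of_list_twice_neq) (auto intro!: hd_in_set)
  ultimately have "s \<in> {\<sigma>. \<sigma> \<in> supported_perms G \<and> (\<exists>x. \<sigma> (\<sigma> x) \<noteq> x)}" by blast
  then show ?thesis unfolding cycle_sum_def
    using finite_supported_perms[OF pair_finite_verts] assms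
    by (intro sum_pos) auto
qed

lemma cmod_char_poly_gain_adjacency_mat:
  assumes vs: "distinct vs" "set vs = pverts G" and p: "graph_cycle G p"
  shows "cmod (poly (char_poly (gain_adjacency_mat G \<phi> vs)) (\<i> * of_real y)) =
    cmod (\<i> ^ (girth G mod 4) * of_real (matching_sum G y) -
      of_real (Re (walk_gain \<phi> p) * cycle_sum G y))" (is "cmod ?P = cmod ?Q")
proof -
  have "card (pverts G) = card (pverts G) - girth G + girth G" using girth_le by simp
  then have "\<i> ^ card (pverts G) = \<i> ^ (card (pverts G) - girth G) * \<i> ^ girth G"
    by (metis power_add)
  also have "\<i> ^ girth G = (\<i> ^ 4) ^ (girth G div 4) * \<i> ^ (girth G mod 4)"
    by (simp only: power_mult[symmetric] power_add[symmetric] mult_div_mod_eq)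
  also have "\<i> ^ 4 = 1" by (simp add: numeral_eq_Suc)
  finally have "?P = \<i> ^ (card (pverts G) - girth G) * ?Q"
    unfolding char_poly_gain_adjacency_mat[OF assms] by (simp add: algebra_simps)
  then show ?thesis by (simp add: norm_mult norm_power)
qed

lemma balanced_iff:
  assumes p: "graph_cycle G p"
  shows "balanced G \<phi> \<longleftrightarrow> Re (walk_gain \<phi> p) = 1"
proof -
  have "walk_gain \<phi> q = 1 \<longleftrightarrow> Re (walk_gain \<phi> p) = 1" if "graph_cycle G q" for q
    using Re_walk_gain_eq_1_iff(1)[of q] graph_cycle_cyclic_arcs[OF that] Re_walk_gain_cong[OF that p]
    by metis
  then show ?thesis unfolding balanced_def using p by blast
qed

lemma walk_gain_uminus: "walk_gain (\<lambda>e. - \<phi> e) p = (-1) ^ length p * walk_gain \<phi> p"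
  unfolding walk_gain_def by (induction p) auto

lemma balanced_uminus_iff:
  assumes p: "graph_cycle G p" and odd: "odd (girth G)"
  shows "balanced G (\<lambda>e. - \<phi> e) \<longleftrightarrow> Re (walk_gain \<phi> p) = -1"
proof -
  have "walk_gain (\<lambda>e. - \<phi> e) q = 1 \<longleftrightarrow> Re (walk_gain \<phi> p) = -1" if q: "graph_cycle G q" for q
  proof -
    have "walk_gain (\<lambda>e. - \<phi> e) q = - walk_gain \<phi> q"
      using unicyclic_girth[OF pair_wf unicyclic q] odd by (simp add: walk_gain_uminus)
    moreover have "walk_gain \<phi> q = -1 \<longleftrightarrow> Re (walk_gain \<phi> p) = -1"
      using Re_walk_gain_eq_1_iff(2)[of q] graph_cycle_cyclic_arcs[OF q] Re_walk_gain_cong[OF q p]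
      by metis
    ultimately show ?thesis by (metis minus_minus)
  qed
  then show ?thesis unfolding balanced_def using p by blast
qed

lemma abs_Re_walk_gain_le_1:
  assumes "graph_cycle G p"
  shows "\<bar>Re (walk_gain \<phi> p)\<bar> \<le> 1"
proof -
  have "cmod (walk_gain \<phi> p) = 1"
    using graph_cycle_cyclic_arcs[OF assms] cmod_walk_gain by metis
  then show ?thesis using abs_Re_le_cmod[of "walk_gain \<phi> p"] by simp
qed

text \<open>The difference never vanishes because the eigenvalues are real, and it is positive for large
  \<open>y\<close>.\<close>

lemma cycle_sum_less_matching_sum:
  assumes balanced: "balanced G \<phi>" and girth: "girth G mod 4 = 0" and y: "y > 0"
  shows "cycle_sum G y < matching_sum G y"
proof (rule ccontr)
  assume "\<not> cycle_sum G y < matching_sum G y"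
  then have le: "matching_sum G y - cycle_sum G y \<le> 0" by simp
  obtain p where p: "graph_cycle G p" by (rule obtain_graph_cycle)
  obtain vs where vs: "set vs = pverts G" "distinct vs"
    using finite_distinct_list[OF pair_finite_verts] by blast
  have ne: "matching_sum G x - cycle_sum G x \<noteq> 0" if "x > 0" for x
  proof -
    have "(\<Prod>a\<in>#spectrum_mset (gain_adjacency_mat G \<phi> vs). x\<^sup>2 + a\<^sup>2) > 0"
      using that by (intro ln_prod_mset[THEN conjunct1]) (simp add: add_pos_nonneg)
    then have "cmod (poly (char_poly (gain_adjacency_mat G \<phi> vs)) (\<i> * of_real x)) \<noteq> 0"
      unfolding hermitian_char_poly_imaginary[OF hermitian_gain_adjacency_mat, symmetric] by auto
    moreover have "cmod (poly (char_poly (gain_adjacency_mat G \<phi> vs)) (\<i> * of_real x)) =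
        cmod (of_real (matching_sum G x - cycle_sum G x))"
      unfolding cmod_char_poly_gain_adjacency_mat[OF vs(2,1) p] girth
      using balanced_iff[OF p] balanced by simp
    ultimately show ?thesis by (metis norm_zero of_real_0)
  qed
  obtain Y where Y: "Y \<ge> y" "cycle_sum G Y < matching_sum G Y"
    using eventually_cycle_sum_less_matching_sum[OF pair_finite_verts] by blast
  have "\<exists>x. y \<le> x \<and> x \<le> Y \<and> matching_sum G x - cycle_sum G x = 0"
    using le Y by (intro IVT) (auto intro!: isCont_diff isCont_matching_sum isCont_cycle_sum)
  then show False using ne y by force
qed

end

context
  fixes M N h :: real
  assumes N: "0 < N" and h: "\<bar>h\<bar> \<le> 1"
begin

lemma cmod_compare_0:
  assumes "N < M" "h \<noteq> 1"
  shows "cmod (of_real M - of_real (1 * N)) < cmod (of_real M - of_real (h * N))"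
proof -
  have "h * N < 1 * N" using N h assms by (intro mult_strict_right_mono) auto
  then show ?thesis using assms(1) unfolding of_real_diff[symmetric] norm_of_real by simp
qed

lemma cmod_compare_2:
  assumes "0 < M" "h \<noteq> 1"
  shows "cmod (- of_real M - of_real (h * N)) < cmod (- of_real M - of_real (1 * N))"
proof -
  have "h * N < 1 * N" using N h assms by (intro mult_strict_right_mono) auto
  moreover have "(-1) * N \<le> h * N" using N h by (intro mult_right_mono) auto
  ultimately have "\<bar>- M - h * N\<bar> < \<bar>- M - 1 * N\<bar>" using assms(1) N by linarith
  then show ?thesis unfolding of_real_minus[symmetric] of_real_diff[symmetric] norm_of_real .
qed

lemma cmod_compare_odd:
  assumes "z = \<i> \<or> z = - \<i>"
  shows "\<bar>h\<bar> \<noteq> 1 \<Longrightarrow> cmod (z * of_real M - of_real (h * N)) < cmod (z * of_real M - of_real (1 * N))"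
    and "\<bar>h\<bar> = 1 \<Longrightarrow> cmod (z * of_real M - of_real (h * N)) = cmod (z * of_real M - of_real (1 * N))"
proof -
  have cmod: "cmod (z * of_real M - of_real (k * N)) = sqrt (M\<^sup>2 + k\<^sup>2 * N\<^sup>2)" for k
    using assms by (auto simp: cmod_def power_mult_distrib add.commute)
  show "cmod (z * of_real M - of_real (h * N)) < cmod (z * of_real M - of_real (1 * N))"
    if "\<bar>h\<bar> \<noteq> 1"
  proof -
    have "h\<^sup>2 < 1" using h that by (simp add: abs_square_less_1)
    then have "h\<^sup>2 * N\<^sup>2 < 1\<^sup>2 * N\<^sup>2" using N by simp
    then show ?thesis unfolding cmod by simp
  qed
  show "cmod (z * of_real M - of_real (h * N)) = cmod (z * of_real M - of_real (1 * N))"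
    if "\<bar>h\<bar> = 1"
  proof -
    have "h\<^sup>2 = 1" using that by (simp add: abs_square_eq_1)
    then show ?thesis unfolding cmod by simp
  qed
qed

end

theorem theorem5p1:
  fixes G :: "'a pair_pre_digraph" and \<phi> :: "'a \<times> 'a \<Rightarrow> complex"
    and vs :: "'a list" and r :: nat
  assumes "gain_graph G \<phi>"
    and "unicyclic G"
    and "girth G = r"
    and "distinct vs" and "set vs = pverts G"
  shows
    "(r mod 4 = 0 \<longrightarrow>
        gain_energy G \<phi> vs \<ge> graph_energy G vs \<and>
        (gain_energy G \<phi> vs = graph_energy G vs \<longleftrightarrow> balanced G \<phi>)) \<and>
     (r mod 4 = 1 \<or> r mod 4 = 3 \<longrightarrow>
        gain_energy G \<phi> vs \<le> graph_energy G vs \<and>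
        (gain_energy G \<phi> vs = graph_energy G vs \<longleftrightarrow>
          balanced G \<phi> \<or> balanced G (\<lambda>e. - \<phi> e))) \<and>
     (r mod 4 = 2 \<longrightarrow>
        gain_energy G \<phi> vs \<le> graph_energy G vs \<and>
        (gain_energy G \<phi> vs = graph_energy G vs \<longleftrightarrow> balanced G \<phi>))"
proof -
  interpret gain_graph G \<phi> by fact
  interpret unicyclic_gain_graph G \<phi> by unfold_locales fact
  interpret one: unicyclic_gain_graph G "\<lambda>_. 1" by unfold_locales (simp_all add: unicyclic)
  obtain p where p: "graph_cycle G p" by (rule obtain_graph_cycle)
  define h where "h = Re (walk_gain \<phi> p)"
  have h: "\<bar>h\<bar> \<le> 1" unfolding h_def by (rule abs_Re_walk_gain_le_1[OF p])
  have one_gain: "walk_gain (\<lambda>_. 1) p = 1" for p :: "('a \<times> 'a) list"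
    unfolding walk_gain_def by (induction p) simp_all
  then have one_balanced: "balanced G (\<lambda>_. 1)" by (simp add: balanced_def)
  have adj: "adjacency_mat G vs = gain_adjacency_mat G (\<lambda>_. 1) vs"
    by (simp add: adjacency_mat_def gain_adjacency_mat_def)
  have gain_value: "cmod (poly (char_poly (gain_adjacency_mat G \<phi> vs)) (\<i> * of_real y)) =
      cmod (\<i> ^ (r mod 4) * of_real (matching_sum G y) - of_real (h * cycle_sum G y))" for y
    using cmod_char_poly_gain_adjacency_mat[OF assms(4,5) p] assms(3) by (simp add: h_def)
  have graph_value: "cmod (poly (char_poly (adjacency_mat G vs)) (\<i> * of_real y)) =
      cmod (\<i> ^ (r mod 4) * of_real (matching_sum G y) - of_real (1 * cycle_sum G y))" for y
    using one.cmod_char_poly_gain_adjacency_mat[OF assms(4,5) p] assms(3) one_gain by (simp add: adj)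
  note herm = hermitian_gain_adjacency_mat[of vs] one.hermitian_gain_adjacency_mat[of vs, folded adj]
  note compare = hermitian_energy_compare[OF herm, folded gain_energy_def graph_energy_def,
      unfolded gain_value graph_value]
  note compare' = hermitian_energy_compare[OF herm(2,1), folded gain_energy_def graph_energy_def,
      unfolded gain_value graph_value]
  have M_pos: "matching_sum G y > 0" if "y > 0" for y
    using matching_sum_ge[OF pair_finite_verts that] zero_less_power[OF that] by (rule less_le_trans[rotated])
  have N_pos: "cycle_sum G y > 0" if "y > 0" for y using that by (rule cycle_sum_pos)
  have balanced_h: "balanced G \<phi> \<longleftrightarrow> h = 1" unfolding h_def by (rule balanced_iff[OF p])
  have equal: "gain_energy G \<phi> vs = graph_energy G vs" if "h = 1"
    by (rule compare(1)) (simp add: that)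
  have mod_0: "graph_energy G vs < gain_energy G \<phi> vs" if "r mod 4 = 0" "h \<noteq> 1"
  proof (rule compare'(2))
    fix y :: real assume y: "y > 0"
    have "cycle_sum G y < matching_sum G y"
      using one.cycle_sum_less_matching_sum[OF one_balanced _ y] assms(3) that(1) by simp
    from cmod_compare_0[OF N_pos[OF y] h this that(2)]
    show "cmod (\<i> ^ (r mod 4) * of_real (matching_sum G y) - of_real (1 * cycle_sum G y)) <
        cmod (\<i> ^ (r mod 4) * of_real (matching_sum G y) - of_real (h * cycle_sum G y))"
      using that(1) by simp
  qed
  have mod_2: "gain_energy G \<phi> vs < graph_energy G vs" if "r mod 4 = 2" "h \<noteq> 1"
  proof (rule compare(2))
    fix y :: real assume y: "y > 0"
    from cmod_compare_2[OF N_pos[OF y] h M_pos[OF y] that(2)]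
    show "cmod (\<i> ^ (r mod 4) * of_real (matching_sum G y) - of_real (h * cycle_sum G y)) <
        cmod (\<i> ^ (r mod 4) * of_real (matching_sum G y) - of_real (1 * cycle_sum G y))"
      using that(1) by simp
  qed
  have i_power: "\<i> ^ (r mod 4) = \<i> \<or> \<i> ^ (r mod 4) = - \<i>" if "r mod 4 = 1 \<or> r mod 4 = 3"
    using that by (elim disjE) (simp_all add: power3_eq_cube)
  have mod_odd: "gain_energy G \<phi> vs < graph_energy G vs"
    if "r mod 4 = 1 \<or> r mod 4 = 3" "\<bar>h\<bar> \<noteq> 1"
    by (rule compare(2)) (rule cmod_compare_odd(1)[OF N_pos h i_power[OF that(1)] that(2)])
  have equal_odd: "gain_energy G \<phi> vs = graph_energy G vs"
    if "r mod 4 = 1 \<or> r mod 4 = 3" "\<bar>h\<bar> = 1"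
    by (rule compare(1)) (rule cmod_compare_odd(2)[OF N_pos h i_power[OF that(1)] that(2)])
  have balanced_uminus_h: "balanced G (\<lambda>e. - \<phi> e) \<longleftrightarrow> h = -1"
    if "r mod 4 = 1 \<or> r mod 4 = 3"
  proof -
    have "odd r" using that by presburger
    then show ?thesis unfolding h_def using balanced_uminus_iff[OF p] assms(3) by simp
  qed
  have abs_h: "\<bar>h\<bar> = 1 \<longleftrightarrow> h = 1 \<or> h = -1" by auto
  show ?thesis
  proof (intro conjI impI)
    assume r: "r mod 4 = 0"
    show "graph_energy G vs \<le> gain_energy G \<phi> vs"
      "gain_energy G \<phi> vs = graph_energy G vs \<longleftrightarrow> balanced G \<phi>"
      using equal mod_0[OF r] unfolding balanced_h by fastforce+
  next
    assume r: "r mod 4 = 2"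
    show "gain_energy G \<phi> vs \<le> graph_energy G vs"
      "gain_energy G \<phi> vs = graph_energy G vs \<longleftrightarrow> balanced G \<phi>"
      using equal mod_2[OF r] unfolding balanced_h by fastforce+
  next
    assume r: "r mod 4 = 1 \<or> r mod 4 = 3"
    show "gain_energy G \<phi> vs \<le> graph_energy G vs"
      "gain_energy G \<phi> vs = graph_energy G vs \<longleftrightarrow> balanced G \<phi> \<or> balanced G (\<lambda>e. - \<phi> e)"
      using equal_odd[OF r] mod_odd[OF r] unfolding balanced_h balanced_uminus_h[OF r] abs_h
      by fastforce+
  qed
qed

end
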